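(* Let $m,p\ge1$ and $q\ge 0$ be integers. For $\alpha^{(a)}\in\mathcal{C}^q_{m,p}$, define $$\delta(\alpha^{(a)}):=(-1)^{\binom{p}{2}}\sum_{dQW=0}\frac{c_1^{|\alpha^{(a)}|}\cdot S_{\alpha^\vee}}{J}.$$ Then for every $\alpha^{(a)}\in\mathcal{C}^q_{m,p}$ other than the minimal element $(1,2,\ldots,p)^{(0)}$, the function $\delta$ satisfies the recursion $$\delta(\alpha^{(a)})=\sum_{\beta^{(b)}\lessdot\alpha^{(a)}}\delta(\beta^{(b)}).$$
   Context: Indices: $\mathcal{C}^q_{m,p}=\{\alpha^{(a)}\mid\alpha=(\alpha_1<\cdots<\alpha_p)\subset\{1,\ldots,m+p\},\ 0\le a\le q\}$, partially ordered by $\alpha^{(a)}\le\beta^{(b)}$ if and only if $a\le b$ and $\alpha_i\le\beta_{b-a+i}$ for $i=1,\ldots,p-b+a$; $\beta^{(b)}\lessdot\alpha^{(a)}$ means that $\alpha^{(a)}$ covers $\beta^{(b)}$. The rank is $|\alpha^{(a)}|=a(m+p)+\sum_i(\alpha_i-i)$. The dual index $\alpha^\vee$ is given by $(\alpha^\vee)_i=m+p+1-\alpha_{p+1-i}$. Let $c_1,\ldots,c_p$ be the elementary symmetric polynomials in variables $x_1,\ldots,x_p$, so that symmetric polynomials in the $x_i$ over $\mathbb{C}$ are polynomials in $c_1,\ldots,c_p$. Let $QW=\frac{1}{m+p+1}P_{m+p+1}+(-1)^pc_1$, where $P_{m+p+1}=\sum_i x_i^{m+p+1}$, regarded as a polynomial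 in $c_1,\ldots,c_p$. The sum over $dQW=0$ is over all points $(c_1,\ldots,c_p)\in\mathbb{C}^p$ where all $\partial QW/\partial c_j$ vanish, and $J=\det\left(\frac{\partial^2QW}{\partial c_i\partial c_j}\right)$ evaluated at that point. For a sequence $I:0<i_1<i_2<\cdots<i_p$ of integers, $S_I$ is the Schur symmetric polynomial in $x_1,\ldots,x_p$ associated to the partition $(i_p-p,\ldots,i_2-2,i_1-1)$, regarded as a polynomial in $c_1,\ldots,c_p$. The convention $c_1^0=1$ is used even when $c_1=0$. *)

theory Defs
  imports
    Complex_Main
    "HOL-Library.FuncSet"
    "HOL-Library.Poly_Mapping"
    "Jordan_Normal_Form.Determinant"
begin

section \<open>Polynomials over the complex numbers\<close>

text \<open>A polynomial maps exponent vectors to coefficients; the product of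
  \<^theory>\<open>HOL-Library.Poly_Mapping\<close> is the convolution product. The variables of interest
  are numbered \<open>1, \<dots>, p\<close>, and the same type serves for polynomials in
  \<open>x\<^sub>1, \<dots>, x\<^sub>p\<close> and in \<open>c\<^sub>1, \<dots>, c\<^sub>p\<close>.\<close>

type_synonym cpoly = "(nat \<Rightarrow>\<^sub>0 nat) \<Rightarrow>\<^sub>0 complex"

definition Var :: "nat \<Rightarrow> cpoly" where
  "Var i = Poly_Mapping.single (Poly_Mapping.single i 1) 1"

definition Const :: "complex \<Rightarrow> cpoly" where
  "Const a = Poly_Mapping.single 0 a"

definition vars :: "cpoly \<Rightarrow> nat set" where
  "vars Q = (\<Union>e\<in>Poly_Mapping.keys Q. Poly_Mapping.keys e)"

definition eval_poly_with ::
    "(complex \<Rightarrow> 'r) \<Rightarrow> (nat \<Rightarrow> 'r) \<Rightarrow> cpoly \<Rightarrow> 'r::comm_ring_1" where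
  "eval_poly_with \<phi> v Q =
    (\<Sum>e\<in>Poly_Mapping.keys Q. \<phi> (Poly_Mapping.lookup Q e) *
       (\<Prod>i\<in>Poly_Mapping.keys e. v i ^ Poly_Mapping.lookup e i))"

definition eval_at :: "(nat \<Rightarrow> complex) \<Rightarrow> cpoly \<Rightarrow> complex" where
  "eval_at c = eval_poly_with (\<lambda>a. a) c"

definition substitute :: "(nat \<Rightarrow> cpoly) \<Rightarrow> cpoly \<Rightarrow> cpoly" where
  "substitute f = eval_poly_with Const f"

text \<open>The formal partial derivative. The truncated subtraction of exponents is harmless: it
  only matters when variable \<open>j\<close> is absent, and then the coefficient is zero.\<close>

definition pdiff :: "nat \<Rightarrow> cpoly \<Rightarrow> cpoly" where
  "pdiff j Q = (\<Sum>e\<in>Poly_Mapping.keys Q.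
     Poly_Mapping.single (e - Poly_Mapping.single j 1)
       (of_nat (Poly_Mapping.lookup e j) * Poly_Mapping.lookup Q e))"

section \<open>Symmetric polynomials\<close>

definition elem_sym :: "nat \<Rightarrow> nat \<Rightarrow> cpoly" where
  "elem_sym p k = (\<Sum>S | S \<subseteq> {1..p} \<and> card S = k. \<Prod>i\<in>S. Var i)"

definition power_sum :: "nat \<Rightarrow> nat \<Rightarrow> cpoly" where
  "power_sum p k = (\<Sum>i=1..p. Var i ^ k)"

text \<open>The symmetric polynomial \<open>f\<close> in \<open>x\<^sub>1, \<dots>, x\<^sub>p\<close> regarded as a polynomial in the elementary
  symmetric polynomials \<open>c\<^sub>1, \<dots>, c\<^sub>p\<close>; existence and uniqueness are the fundamental theorem of
  symmetric polynomials.\<close>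

definition in_elem_sym :: "nat \<Rightarrow> cpoly \<Rightarrow> cpoly" where
  "in_elem_sym p f = (THE g. vars g \<subseteq> {1..p} \<and> substitute (elem_sym p) g = f)"

text \<open>\<open>det (x\<^sub>i ^ \<mu>\<^sub>j)\<close> for \<open>i, j = 1, \<dots>, p\<close>.\<close>

definition alternant :: "nat \<Rightarrow> (nat \<Rightarrow> nat) \<Rightarrow> cpoly" where
  "alternant p \<mu> = det (mat p p (\<lambda>(i, j). Var (i + 1) ^ \<mu> (j + 1)))"

text \<open>The Schur polynomial of a partition \<open>\<lambda>\<^sub>1 \<ge> \<dots> \<ge> \<lambda>\<^sub>p\<close>, as the quotient of the alternants
  with exponents \<open>\<lambda>\<^sub>j + p - j\<close> and \<open>p - j\<close>.\<close>

definition schur :: "nat \<Rightarrow> (nat \<Rightarrow> nat) \<Rightarrow> cpoly" where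
  "schur p l = (THE s. s * alternant p (\<lambda>j. p - j) = alternant p (\<lambda>j. l j + p - j))"

section \<open>Indices\<close>

text \<open>The index \<open>\<alpha>\<^sup>(\<^sup>a\<^sup>)\<close> is the pair \<open>(\<alpha>, a)\<close>, where \<open>\<alpha>\<close> is the increasing list
  \<open>[\<alpha>\<^sub>1, \<dots>, \<alpha>\<^sub>p]\<close>.\<close>

definition entry :: "nat list \<Rightarrow> nat \<Rightarrow> nat" where
  "entry \<alpha> i = \<alpha> ! (i - 1)"

definition indices :: "nat \<Rightarrow> nat \<Rightarrow> nat \<Rightarrow> (nat list \<times> nat) set" where
  "indices q m p =
    {(\<alpha>, a). length \<alpha> = p \<and> sorted_wrt (<) \<alpha> \<and> set \<alpha> \<subseteq> {1..m + p} \<and> a \<le> q}"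

text \<open>For \<open>b - a > p\<close> the range \<open>i = 1, \<dots>, p - b + a\<close> is empty, which agrees with the truncated
  subtraction below.\<close>

definition index_le :: "nat \<Rightarrow> nat list \<times> nat \<Rightarrow> nat list \<times> nat \<Rightarrow> bool" where
  "index_le p = (\<lambda>(\<alpha>, a) (\<beta>, b).
     a \<le> b \<and> (\<forall>i\<in>{1..p - (b - a)}. entry \<alpha> i \<le> entry \<beta> (b - a + i)))"

definition index_less :: "nat \<Rightarrow> nat list \<times> nat \<Rightarrow> nat list \<times> nat \<Rightarrow> bool" where
  "index_less p y z \<longleftrightarrow> index_le p y z \<and> y \<noteq> z"

definition covered_by ::
    "nat \<Rightarrow> nat \<Rightarrow> nat \<Rightarrow> nat list \<times> nat \<Rightarrow> nat list \<times> nat \<Rightarrow> bool" where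
  "covered_by q m p y z \<longleftrightarrow> y \<in> indices q m p \<and> z \<in> indices q m p \<and> index_less p y z \<and>
     \<not> (\<exists>w\<in>indices q m p. index_less p y w \<and> index_less p w z)"

text \<open>On \<open>indices q m p\<close> we have \<open>\<alpha>\<^sub>i \<ge> i\<close>, so the subtraction does not truncate; likewise in \<open>dual\<close> and
  \<open>schur_seq\<close>.\<close>

definition index_rank :: "nat \<Rightarrow> nat \<Rightarrow> nat list \<times> nat \<Rightarrow> nat" where
  "index_rank m p = (\<lambda>(\<alpha>, a). a * (m + p) + (\<Sum>i=1..p. entry \<alpha> i - i))"

definition dual :: "nat \<Rightarrow> nat \<Rightarrow> nat list \<Rightarrow> nat list" where
  "dual m p \<alpha> = map (\<lambda>i. m + p + 1 - entry \<alpha> (p + 1 - i)) [1..<p + 1]"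

text \<open>\<open>S\<^sub>I\<close> for \<open>I = [i\<^sub>1, \<dots>, i\<^sub>p]\<close>: the partition is \<open>(i\<^sub>p - p, \<dots>, i\<^sub>1 - 1)\<close>.\<close>

definition schur_seq :: "nat \<Rightarrow> nat list \<Rightarrow> cpoly" where
  "schur_seq p I = schur p (\<lambda>j. entry I (p + 1 - j) - (p + 1 - j))"

section \<open>The potential and the function delta\<close>

definition QW :: "nat \<Rightarrow> nat \<Rightarrow> cpoly" where
  "QW m p = Const (1 / of_nat (m + p + 1)) * in_elem_sym p (power_sum p (m + p + 1))
     + (- 1) ^ p * Var 1"

text \<open>Points of \<open>\<complex>\<^sup>p\<close> are functions on \<open>{1..p}\<close>, extended by \<open>undefined\<close>. There are only
  finitely many critical points and the Hessian determinant vanishes at none of them.\<close>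

definition crit_points :: "nat \<Rightarrow> nat \<Rightarrow> (nat \<Rightarrow> complex) set" where
  "crit_points m p = {c \<in> {1..p} \<rightarrow>\<^sub>E UNIV. \<forall>j\<in>{1..p}. eval_at c (pdiff j (QW m p)) = 0}"

definition hessian_det :: "nat \<Rightarrow> nat \<Rightarrow> (nat \<Rightarrow> complex) \<Rightarrow> complex" where
  "hessian_det m p c =
     det (mat p p (\<lambda>(i, j). eval_at c (pdiff (i + 1) (pdiff (j + 1) (QW m p)))))"

definition delta :: "nat \<Rightarrow> nat \<Rightarrow> nat list \<times> nat \<Rightarrow> complex" where
  "delta m p = (\<lambda>(\<alpha>, a). (- 1) ^ (p choose 2) *
     (\<Sum>c\<in>crit_points m p.
        c 1 ^ index_rank m p (\<alpha>, a)
          * eval_at c (in_elem_sym p (schur_seq p (dual m p \<alpha>)))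
        / hessian_det m p c))"

end

theory Submission
  imports Defs "HOL-Computational_Algebra.Fundamental_Theorem_Algebra"
begin

text \<open>Write \<open>n = m + p\<close>, let \<open>e\<^sub>k\<close> be the elementary symmetric polynomials and pull everything
  back along \<open>x \<mapsto> (e\<^sub>1(x), \<dots>, e\<^sub>p(x))\<close>. The potential becomes
  \<open>\<Sum>\<^sub>i x\<^sub>i ^ (n + 1) / (n + 1) + (-1) ^ p \<Sum>\<^sub>i x\<^sub>i\<close>, whose critical points are given by
  \<open>x\<^sub>i ^ n = (-1) ^ (p + 1)\<close> in each coordinate separately. The points with \<open>dQW = 0\<close> are the images
  of the tuples of pairwise distinct roots (\<open>crit_points_eq\<close>), each image of exactly \<open>p!\<close> tuples.
  Tuples with a repeated coordinate need care, because the map to the \<open>c\<^sub>j\<close> is not immersive there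
  (\<open>inj_on_if_QW_grad_0\<close>). The chain rule gives \<open>J \<Delta>\<^sup>2 = \<Prod>\<^sub>i n x\<^sub>i ^ (n - 1)\<close> with \<open>\<Delta>\<close> the Vandermonde
  determinant (\<open>hessian_det_elem_point\<close>), and Schur polynomials are quotients of alternants by
  \<open>\<Delta>\<close>. Hence, up to a constant depending only on \<open>m\<close> and \<open>p\<close>,
  \<open>\<delta>(\<alpha>\<^sup>(\<^sup>a\<^sup>)) = \<Sum>\<^sub>x e\<^sub>1(x) ^ r \<cdot> det (x\<^sub>i ^ \<mu>\<^sub>j) \<cdot> \<Delta>(x) \<cdot> \<Prod>\<^sub>i x\<^sub>i\<close>, where \<open>r = |\<alpha>\<^sup>(\<^sup>a\<^sup>)|\<close>, \<open>\<mu>\<^sub>j = n - \<alpha>\<^sub>j\<close>, and \<open>x\<close>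
  runs over all tuples of roots (\<open>residue_sum_eq_alt_sum\<close>, \<open>delta_eq_alt_sum\<close>).

  The recursion is now Pieri's rule: multiplying an alternant by \<open>e\<^sub>1\<close> raises each \<open>\<mu>\<^sub>k\<close> by one
  in turn (\<open>sum_times_alt\<close>), that is, lowers each \<open>\<alpha>\<^sub>k\<close> by one. If the lowered sequence repeats an
  entry, the alternant has two equal columns and vanishes. If \<open>\<alpha>\<^sub>1 = 1\<close>, the first column becomes
  \<open>x\<^sub>i ^ n = (-1) ^ (p + 1)\<close>; moving this constant column to the end costs the same sign, and the
  result is the alternant of \<open>(\<alpha>\<^sub>2, \<dots>, \<alpha>\<^sub>p, n)\<close> (\<open>alt_quantum_shift\<close>), zero if \<open>\<alpha>\<^sub>p = n\<close>. These are
  exactly the indices covered by \<open>\<alpha>\<^sup>(\<^sup>a\<^sup>)\<close> (\<open>covered_by_eq\<close>), except that for \<open>a = 0\<close> there is no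
  index \<open>(\<alpha>\<^sub>2, \<dots>, \<alpha>\<^sub>p, n)\<^sup>(\<^sup>a\<^sup>-\<^sup>1\<^sup>)\<close>. In that case the extra term vanishes for reasons of degree: a sum
  over the \<open>n\<close>-th roots of a constant kills every power \<open>0 < e < n\<close>, so a monomial in which all
  variables occur survives only if its degree is at least \<open>p n\<close> (\<open>alt_sum_rotate_eq_0\<close>).\<close>

section \<open>Evaluation and substitution of polynomials\<close>

lemma single_eq_Const_times_Vars:
  "Poly_Mapping.single e a = Const a * (\<Prod>i\<in>Poly_Mapping.keys e. Var i ^ Poly_Mapping.lookup e i)"
proof -
  have pow: "Var i ^ k = Poly_Mapping.single (Poly_Mapping.single i k) 1" for i k
    by (induction k) (auto simp: Var_def mult_single single_add[symmetric])
  have "(\<Prod>i\<in>A. Var i ^ Poly_Mapping.lookup e i)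
      = Poly_Mapping.single (\<Sum>i\<in>A. Poly_Mapping.single i (Poly_Mapping.lookup e i)) 1"
    if "finite A" for A
    using that by (induction A) (auto simp: pow mult_single)
  moreover have "(\<Sum>i\<in>Poly_Mapping.keys e. Poly_Mapping.single i (Poly_Mapping.lookup e i)) = e"
    by (rule poly_mapping_eqI)
       (auto simp: lookup_sum lookup_single when_def sum.If_cases Int_absorb2 in_keys_iff)
  ultimately show ?thesis by (simp add: Const_def mult_single)
qed

lemma poly_eq_sum_single:
  "Q = (\<Sum>e\<in>Poly_Mapping.keys Q. Poly_Mapping.single e (Poly_Mapping.lookup Q e))"
  by (rule poly_mapping_eqI)
     (auto simp: lookup_sum lookup_single when_def sum.If_cases Int_absorb2 in_keys_iff)

text \<open>Multiplying by one variable at a time keeps exponent vectors out of sight: homomorphism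
  properties, the Leibniz rule and the chain rule all become inductions with three trivial cases.\<close>

lemma cpoly_induct [case_names Const add Var]:
  assumes C: "\<And>a. P (Const a)" and A: "\<And>f g. P f \<Longrightarrow> P g \<Longrightarrow> P (f + g)"
    and V: "\<And>i f. P f \<Longrightarrow> P (Var i * f)"
  shows "P (Q :: cpoly)"
proof -
  have pow: "P (Var i ^ k * f)" if "P f" for i k f
    using that by (induction k) (auto simp: mult.assoc intro: V)
  have "P ((\<Prod>i\<in>A. Var i ^ k i) * f)" if "finite A" "P f" for A k f
    using that by (induction A) (auto simp: mult.assoc intro: pow)
  from this[OF finite_keys C] have mon: "P (Poly_Mapping.single e a)" for e a
    by (simp add: single_eq_Const_times_Vars mult.commute)
  have P0: "P 0" using C[of 0] by (simp add: Const_def)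
  have "P (sum (\<lambda>e. Poly_Mapping.single e (Poly_Mapping.lookup Q e)) A)" if "finite A" for A
    using that by (induction A) (auto intro: P0 A mon)
  from this[OF finite_keys[of Q]] show ?thesis by (simp only: poly_eq_sum_single[symmetric])
qed

text \<open>Evaluation at a point and substitution of polynomials are the instances with the identity and
  with \<^const>\<open>Const\<close> as coefficient map.\<close>

locale coefficient_hom =
  fixes \<phi> :: "complex \<Rightarrow> 'r::comm_ring_1"
  assumes hom_add: "\<phi> (a + b) = \<phi> a + \<phi> b" and hom_mult: "\<phi> (a * b) = \<phi> a * \<phi> b"
    and hom_one: "\<phi> 1 = 1"
begin

lemma hom_zero: "\<phi> 0 = 0"
  using hom_add[of 0 0] by simp

lemma eval_poly_with_superset:
  assumes "finite A" "Poly_Mapping.keys Q \<subseteq> A"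
  shows "eval_poly_with \<phi> v Q = (\<Sum>e\<in>A. \<phi> (Poly_Mapping.lookup Q e) *
       (\<Prod>i\<in>Poly_Mapping.keys e. v i ^ Poly_Mapping.lookup e i))"
  unfolding eval_poly_with_def
  by (rule sum.mono_neutral_left) (use assms in \<open>auto simp: in_keys_iff hom_zero\<close>)

lemma eval_poly_with_add: "eval_poly_with \<phi> v (f + g) = eval_poly_with \<phi> v f + eval_poly_with \<phi> v g"
proof -
  let ?A = "Poly_Mapping.keys f \<union> Poly_Mapping.keys g"
  have "Poly_Mapping.keys (f + g) \<subseteq> ?A" by (rule Poly_Mapping.keys_add)
  then show ?thesis
    by (simp add: eval_poly_with_superset[of ?A] lookup_add hom_add distrib_right sum.distrib)
qed

lemma eval_poly_with_Const: "eval_poly_with \<phi> v (Const a) = \<phi> a"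
  by (simp add: eval_poly_with_def Const_def hom_zero)

lemma eval_poly_with_zero: "eval_poly_with \<phi> v 0 = 0"
  using eval_poly_with_Const[of v 0] by (simp add: Const_def hom_zero)

lemma eval_poly_with_sum: "eval_poly_with \<phi> v (sum f A) = (\<Sum>i\<in>A. eval_poly_with \<phi> v (f i))"
  by (induction A rule: infinite_finite_induct) (auto simp: eval_poly_with_add eval_poly_with_zero)

lemma eval_poly_with_Var_times: "eval_poly_with \<phi> v (Var i * f) = v i * eval_poly_with \<phi> v f"
proof -
  have mono: "eval_poly_with \<phi> v (Var i * Poly_Mapping.single e a)
      = v i * eval_poly_with \<phi> v (Poly_Mapping.single e a)" for e a
  proof -
    let ?s = "Poly_Mapping.single i (1::nat)"
    have P: "(\<Prod>j\<in>Poly_Mapping.keys e'. v j ^ Poly_Mapping.lookup e' j)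
        = (\<Prod>j\<in>insert i (Poly_Mapping.keys e). v j ^ Poly_Mapping.lookup e' j)"
      if "Poly_Mapping.keys e' \<subseteq> insert i (Poly_Mapping.keys e)" for e'
      by (rule prod.mono_neutral_left) (use that in \<open>auto simp: in_keys_iff\<close>)
    have "Poly_Mapping.keys (?s + e) \<subseteq> insert i (Poly_Mapping.keys e)"
      using Poly_Mapping.keys_add[of ?s e] by auto
    then have "(\<Prod>j\<in>Poly_Mapping.keys (?s + e). v j ^ Poly_Mapping.lookup (?s + e) j)
        = (\<Prod>j\<in>insert i (Poly_Mapping.keys e). v j ^ Poly_Mapping.lookup (?s + e) j)"
      by (rule P)
    also have "\<dots> = (\<Prod>j\<in>insert i (Poly_Mapping.keys e).
        (if j = i then v j else 1) * v j ^ Poly_Mapping.lookup e j)"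
      by (rule prod.cong) (auto simp: lookup_add lookup_single)
    also have "\<dots> = v i * (\<Prod>j\<in>insert i (Poly_Mapping.keys e). v j ^ Poly_Mapping.lookup e j)"
      by (simp only: prod.distrib prod.delta' finite_insert finite_keys insertI1 if_True prod.delta)
    also have "(\<Prod>j\<in>insert i (Poly_Mapping.keys e). v j ^ Poly_Mapping.lookup e j)
        = (\<Prod>j\<in>Poly_Mapping.keys e. v j ^ Poly_Mapping.lookup e j)"
      by (rule P[symmetric]) auto
    finally have "(\<Prod>j\<in>Poly_Mapping.keys (?s + e). v j ^ Poly_Mapping.lookup (?s + e) j)
        = v i * (\<Prod>j\<in>Poly_Mapping.keys e. v j ^ Poly_Mapping.lookup e j)" .
    then show ?thesis
      by (simp add: Var_def mult_single eval_poly_with_def hom_zero mult.left_commute)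
  qed
  have "Var i * f = (\<Sum>e\<in>Poly_Mapping.keys f. Var i * Poly_Mapping.single e (Poly_Mapping.lookup f e))"
    by (subst poly_eq_sum_single[of f]) (simp add: sum_distrib_left)
  then have "eval_poly_with \<phi> v (Var i * f) = (\<Sum>e\<in>Poly_Mapping.keys f. v i * eval_poly_with \<phi> v (Poly_Mapping.single e (Poly_Mapping.lookup f e)))"
    by (simp add: eval_poly_with_sum mono)
  also have "\<dots> = v i * eval_poly_with \<phi> v f"
    by (subst (2) poly_eq_sum_single[of f]) (simp add: eval_poly_with_sum sum_distrib_left)
  finally show ?thesis .
qed

lemma eval_poly_with_Const_times: "eval_poly_with \<phi> v (Const a * f) = \<phi> a * eval_poly_with \<phi> v f"
proof (induction f rule: cpoly_induct)
  case (Const b)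
  have "Const a * Const b = Const (a * b)" by (simp add: Const_def mult_single)
  then show ?case by (simp add: eval_poly_with_Const hom_mult)
next
  case (Var i f)
  have eq: "Const a * (Var i * f) = Var i * (Const a * f)" by (simp only: mult.left_commute)
  show ?case by (simp only: eq eval_poly_with_Var_times Var) (simp only: mult.left_commute)
qed (simp_all add: eval_poly_with_add distrib_left)

lemma eval_poly_with_mult: "eval_poly_with \<phi> v (f * g) = eval_poly_with \<phi> v f * eval_poly_with \<phi> v g"
proof (induction f rule: cpoly_induct)
qed (simp_all add: eval_poly_with_Const eval_poly_with_Const_times eval_poly_with_add eval_poly_with_Var_times distrib_right mult.assoc)

lemma eval_poly_with_one: "eval_poly_with \<phi> v 1 = 1"
  using eval_poly_with_Const[of v 1] by (simp add: Const_def hom_one)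

lemma eval_poly_with_Var: "eval_poly_with \<phi> v (Var i) = v i"
  using eval_poly_with_Var_times[of v i 1] by (simp add: eval_poly_with_one)

lemma comm_ring_hom_eval_poly_with: "comm_ring_hom (eval_poly_with \<phi> v)"
  by unfold_locales (simp_all add: eval_poly_with_add eval_poly_with_mult eval_poly_with_one eval_poly_with_zero)

end

lemma comm_ring_hom_eval_at: "comm_ring_hom (eval_at c)"
proof -
  interpret coefficient_hom "\<lambda>a::complex. a" by unfold_locales simp_all
  show ?thesis unfolding eval_at_def by (rule comm_ring_hom_eval_poly_with)
qed

lemma eval_at_Var [simp]: "eval_at c (Var i) = c i"
proof -
  interpret coefficient_hom "\<lambda>a::complex. a" by unfold_locales simp_all
  show ?thesis unfolding eval_at_def by (rule eval_poly_with_Var)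
qed

lemma eval_at_Const [simp]: "eval_at c (Const a) = a"
proof -
  interpret coefficient_hom "\<lambda>a::complex. a" by unfold_locales simp_all
  show ?thesis unfolding eval_at_def by (rule eval_poly_with_Const)
qed

lemma coefficient_hom_Const: "coefficient_hom Const"
  by unfold_locales (simp_all add: Const_def single_add mult_single)

lemma comm_ring_hom_substitute: "comm_ring_hom (substitute f)"
  unfolding substitute_def by (rule coefficient_hom.comm_ring_hom_eval_poly_with[OF coefficient_hom_Const])

lemma substitute_Var [simp]: "substitute f (Var i) = f i"
  unfolding substitute_def by (rule coefficient_hom.eval_poly_with_Var[OF coefficient_hom_Const])

lemma substitute_Const [simp]: "substitute f (Const a) = Const a"
  unfolding substitute_def by (rule coefficient_hom.eval_poly_with_Const[OF coefficient_hom_Const])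

interpretation eval_at: comm_ring_hom "eval_at c" for c
  by (rule comm_ring_hom_eval_at)

interpretation substitute: comm_ring_hom "substitute f" for f
  by (rule comm_ring_hom_substitute)

lemma eval_at_substitute: "eval_at x (substitute f g) = eval_at (\<lambda>j. eval_at x (f j)) g"
  by (induction g rule: cpoly_induct) (simp_all add: eval_at.hom_add eval_at.hom_mult substitute.hom_add substitute.hom_mult)

section \<open>Formal derivatives\<close>

lemma pdiff_single:
  "pdiff j (Poly_Mapping.single e a) =
    Poly_Mapping.single (e - Poly_Mapping.single j 1) (of_nat (Poly_Mapping.lookup e j) * a)"
  by (simp add: pdiff_def)

lemma pdiff_superset:
  assumes "finite A" "Poly_Mapping.keys Q \<subseteq> A"
  shows "pdiff j Q = (\<Sum>e\<in>A. Poly_Mapping.single (e - Poly_Mapping.single j 1)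
       (of_nat (Poly_Mapping.lookup e j) * Poly_Mapping.lookup Q e))"
  unfolding pdiff_def
  by (rule sum.mono_neutral_left) (use assms in \<open>auto simp: in_keys_iff\<close>)

lemma pdiff_add: "pdiff j (f + g) = pdiff j f + pdiff j g"
proof -
  let ?A = "Poly_Mapping.keys f \<union> Poly_Mapping.keys g"
  have "Poly_Mapping.keys (f + g) \<subseteq> ?A" by (rule Poly_Mapping.keys_add)
  then show ?thesis
    by (simp add: pdiff_superset[of ?A] lookup_add distrib_left sum.distrib single_add)
qed

lemma pdiff_Const [simp]: "pdiff j (Const a) = 0"
  by (simp add: Const_def pdiff_single)

lemma pdiff_0 [simp]: "pdiff j 0 = 0" 
  using pdiff_Const[of j 0] by (simp add: Const_def)

lemma pdiff_1 [simp]: "pdiff j 1 = 0"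
  using pdiff_Const[of j 1] by (simp add: Const_def)

lemma pdiff_sum: "pdiff j (sum f A) = (\<Sum>i\<in>A. pdiff j (f i))"
  by (induction A rule: infinite_finite_induct) (simp_all add: pdiff_add)

lemma pdiff_Var_times: "pdiff j (Var i * f) = (if i = j then f else 0) + Var i * pdiff j f"
proof -
  have mono: "pdiff j (Var i * Poly_Mapping.single e a)
      = (if i = j then Poly_Mapping.single e a else 0) + Var i * pdiff j (Poly_Mapping.single e a)" for e a
  proof -
    let ?si = "Poly_Mapping.single i (1::nat)" and ?sj = "Poly_Mapping.single j (1::nat)"
    have "?si + e - ?sj = (if i = j then e else ?si + (e - ?sj))"
      if "i = j \<or> Poly_Mapping.lookup e j > 0"
      by (rule poly_mapping_eqI) (use that in \<open>auto simp: lookup_add lookup_minus lookup_single when_def\<close>)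
    moreover have "e = ?sj + (e - ?sj)" if "Poly_Mapping.lookup e j > 0"
      by (rule poly_mapping_eqI) (use that in \<open>auto simp: lookup_add lookup_minus lookup_single when_def\<close>)
    ultimately show ?thesis
      by (cases "Poly_Mapping.lookup e j = 0")
        (auto simp: Var_def mult_single pdiff_single lookup_add lookup_single when_def
         distrib_right single_add simp flip: single_add)
  qed
  have "Var i * f = (\<Sum>e\<in>Poly_Mapping.keys f. Var i * Poly_Mapping.single e (Poly_Mapping.lookup f e))"
    by (subst poly_eq_sum_single[of f]) (simp add: sum_distrib_left)
  then have "pdiff j (Var i * f) = (\<Sum>e\<in>Poly_Mapping.keys f.
      (if i = j then Poly_Mapping.single e (Poly_Mapping.lookup f e) else 0)
      + Var i * pdiff j (Poly_Mapping.single e (Poly_Mapping.lookup f e)))"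
    by (simp add: pdiff_sum mono)
  also have "\<dots> = (if i = j then (\<Sum>e\<in>Poly_Mapping.keys f. Poly_Mapping.single e (Poly_Mapping.lookup f e)) else 0)
      + Var i * pdiff j (\<Sum>e\<in>Poly_Mapping.keys f. Poly_Mapping.single e (Poly_Mapping.lookup f e))"
    by (simp add: sum.distrib sum_distrib_left pdiff_sum)
  finally show ?thesis by (simp only: poly_eq_sum_single[symmetric])
qed

lemma pdiff_Const_times: "pdiff j (Const a * f) = Const a * pdiff j f"
proof (induction f rule: cpoly_induct)
  case (Const b)
  have "Const a * Const b = Const (a * b)" by (simp add: Const_def mult_single)
  then show ?case by simp
next
  case (Var i f)
  have eq: "Const a * (Var i * f) = Var i * (Const a * f)" by (simp only: mult.left_commute)
  show ?case by (simp only: eq pdiff_Var_times Var) (simp add: algebra_simps)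
qed (simp_all add: pdiff_add distrib_left)

lemma pdiff_mult: "pdiff j (f * g) = pdiff j f * g + f * pdiff j g"
proof (induction f rule: cpoly_induct)
  case (Var i f)
  show ?case by (simp only: mult.assoc pdiff_Var_times Var) (simp add: algebra_simps)
qed (simp_all add: pdiff_Const_times pdiff_add distrib_right)

lemma pdiff_Var: "pdiff j (Var i) = (if i = j then 1 else 0)"
  using pdiff_Var_times[of j i 1] by simp

lemma pdiff_Var_power: "pdiff j (Var i ^ k) = (if i = j then of_nat k * Var i ^ (k - 1) else 0)"
proof (induction k)
  case (Suc k)
  then show ?case by (cases k) (auto simp: pdiff_Var_times pdiff_Var algebra_simps)
qed simp

text \<open>The chain rule. The set \<open>J\<close> keeps the sum finite: off \<open>J\<close> the inner polynomials do not depend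
  on variable \<open>i\<close>.\<close>

lemma pdiff_substitute:
  assumes "finite J" and off: "\<And>j. j \<notin> J \<Longrightarrow> pdiff i (f j) = 0"
  shows "pdiff i (substitute f g) = (\<Sum>j\<in>J. substitute f (pdiff j g) * pdiff i (f j))"
proof (induction g rule: cpoly_induct)
  case (Const a)
  show ?case by simp
next
  case (add g h)
  then show ?case by (simp add: substitute.hom_add pdiff_add distrib_right sum.distrib)
next
  case (Var k g)
  have "(\<Sum>j\<in>J. substitute f (pdiff j (Var k * g)) * pdiff i (f j))
      = (\<Sum>j\<in>J. if k = j then substitute f g * pdiff i (f k) else 0)
        + f k * (\<Sum>j\<in>J. substitute f (pdiff j g) * pdiff i (f j))"
    unfolding sum_distrib_left sum.distrib[symmetric]
    by (rule sum.cong) (auto simp: pdiff_Var_times substitute.hom_add substitute.hom_mult distrib_right mult.assoc)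
  also have "(\<Sum>j\<in>J. if k = j then substitute f g * pdiff i (f k) else 0) = substitute f g * pdiff i (f k)"
    using \<open>finite J\<close> off by (auto simp: sum.delta)
  finally show ?case
    by (simp add: substitute.hom_mult pdiff_mult Var mult.commute)
qed

section \<open>Polynomials that vanish everywhere\<close>

lemma base_expansion_unique:
  fixes a b :: "nat \<Rightarrow> nat"
  assumes "(\<Sum>i<k. a i * N ^ i) = (\<Sum>i<k. b i * N ^ i)" "\<And>i. a i < N" "\<And>i. b i < N" "i < k"
  shows "a i = b i"
  using assms
proof (induction k arbitrary: a b i)
  case (Suc k)
  have exp: "(\<Sum>i<Suc k. f i * N ^ i) = f 0 + N * (\<Sum>i<k. f (Suc i) * N ^ i)" for f :: "nat \<Rightarrow> nat"
    by (simp only: sum.lessThan_Suc_shift) (simp add: sum_distrib_left algebra_simps)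
  have eq: "a 0 + N * (\<Sum>i<k. a (Suc i) * N ^ i) = b 0 + N * (\<Sum>i<k. b (Suc i) * N ^ i)"
    using Suc.prems(1) by (simp only: exp)
  have 0: "a 0 = b 0" using arg_cong[OF eq, of "\<lambda>x. x mod N"] Suc.prems(2,3) by simp
  have "N > 0" using Suc.prems(2)[of 0] by simp
  with 0 eq have "(\<Sum>i<k. a (Suc i) * N ^ i) = (\<Sum>i<k. b (Suc i) * N ^ i)" by simp
  from Suc.IH[OF this] Suc.prems(2,3,4) 0 show ?case by (cases i) auto
qed simp

text \<open>Kronecker substitution: if \<open>N\<close> exceeds all exponents, then \<open>c\<^sub>i = t ^ N ^ i\<close> sends different
  monomials to different powers of \<open>t\<close>, since exponents become the digits of a number in base
  \<open>N\<close>. This reduces the claim to polynomials in one variable.\<close>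

lemma cpoly_eq_0_if_eval_0:
  assumes vars: "vars g \<subseteq> {1..p}" and eval: "\<And>c. eval_at c g = 0"
  shows "g = 0"
proof (rule poly_mapping_eqI)
  fix e0
  define K where "K = Poly_Mapping.keys g"
  \<comment> \<open>Any strict bound on the exponents will do; a sum avoids maxima over empty sets.\<close>
  define N where "N = Suc (\<Sum>e\<in>K. \<Sum>i\<in>Poly_Mapping.keys e. Poly_Mapping.lookup e i)"
  define w where "w e = (\<Sum>i<Suc p. Poly_Mapping.lookup e i * N ^ i)" for e
  have digit: "Poly_Mapping.lookup e i < N" if "e \<in> K" for e i
  proof (cases "i \<in> Poly_Mapping.keys e")
    case True
    have "Poly_Mapping.lookup e i \<le> (\<Sum>i\<in>Poly_Mapping.keys e. Poly_Mapping.lookup e i)"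
      by (rule member_le_sum) (use True in auto)
    also have "\<dots> \<le> (\<Sum>e\<in>K. \<Sum>i\<in>Poly_Mapping.keys e. Poly_Mapping.lookup e i)"
      by (rule member_le_sum[of e K "\<lambda>e. \<Sum>i\<in>Poly_Mapping.keys e. Poly_Mapping.lookup e i"]) (use that in \<open>auto simp: K_def\<close>)
    finally show ?thesis by (simp add: N_def)
  qed (simp add: in_keys_iff N_def)
  have keys: "Poly_Mapping.keys e \<subseteq> {..<Suc p}" if "e \<in> K" for e
    using vars that by (force simp: vars_def K_def)
  have inj: "inj_on w K"
  proof (rule inj_onI)
    fix e e' assume e: "e \<in> K" "e' \<in> K" "w e = w e'"
    show "e = e'"
    proof (rule poly_mapping_eqI)
      fix i
      show "Poly_Mapping.lookup e i = Poly_Mapping.lookup e' i"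
      proof (cases "i < Suc p")
        case True
        then show ?thesis
          using base_expansion_unique[OF e(3)[unfolded w_def]] digit e by blast
      next
        case False
        then have "i \<notin> Poly_Mapping.keys e" "i \<notin> Poly_Mapping.keys e'" using keys e by blast+
        then show ?thesis by (simp add: in_keys_iff)
      qed
    qed
  qed
  define P where "P = (\<Sum>e\<in>K. monom (Poly_Mapping.lookup g e) (w e))"
  have "poly P t = 0" for t
  proof -
    have "(\<Prod>i\<in>Poly_Mapping.keys e. (t ^ N ^ i) ^ Poly_Mapping.lookup e i) = t ^ w e" if "e \<in> K" for e
    proof -
      have "(\<Prod>i\<in>Poly_Mapping.keys e. (t ^ N ^ i) ^ Poly_Mapping.lookup e i)
          = (\<Prod>i<Suc p. (t ^ N ^ i) ^ Poly_Mapping.lookup e i)"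
        by (rule prod.mono_neutral_left) (use keys[OF that] in \<open>auto simp: in_keys_iff\<close>)
      also have "\<dots> = t ^ w e"
        unfolding w_def power_sum by (simp only: power_mult[symmetric] mult.commute)
      finally show ?thesis .
    qed
    then have "poly P t = eval_at (\<lambda>i. t ^ N ^ i) g"
      by (simp add: P_def poly_sum poly_monom eval_at_def eval_poly_with_def K_def)
    then show ?thesis using eval by simp
  qed
  then have "P = 0" using poly_all_0_iff_0 by blast
  then have c0: "coeff P (w e0) = 0" by simp
  show "Poly_Mapping.lookup g e0 = Poly_Mapping.lookup 0 e0"
  proof (cases "e0 \<in> K")
    case True
    have "coeff P (w e0) = (\<Sum>e\<in>K. if e = e0 then Poly_Mapping.lookup g e else 0)"
      unfolding P_def coeff_sum coeff_monom
      by (rule sum.cong) (use True inj in \<open>auto simp: inj_on_def\<close>)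
    then show ?thesis using c0 True by (simp add: K_def)
  qed (simp add: K_def in_keys_iff)
qed

section \<open>Elementary symmetric functions\<close>

text \<open>The values of the elementary symmetric polynomials in an arbitrary ring and over an arbitrary
  index set; removing an index from the set is what makes derivatives accessible.\<close>

definition esym :: "'i set \<Rightarrow> ('i \<Rightarrow> 'a::comm_ring_1) \<Rightarrow> nat \<Rightarrow> 'a" where
  "esym A v k = (\<Sum>S | S \<subseteq> A \<and> card S = k. \<Prod>i\<in>S. v i)"

lemma esym_0: "finite A \<Longrightarrow> esym A v 0 = 1"
proof -
  assume "finite A"
  then have eq: "{S. S \<subseteq> A \<and> card S = 0} = {{}}"
    by (auto dest: finite_subset)
  show ?thesis unfolding esym_def eq by simp
qed

lemma esym_eq_0: "finite A \<Longrightarrow> card A < k \<Longrightarrow> esym A v k = 0"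
proof -
  assume "finite A" "card A < k"
  then have "{S. S \<subseteq> A \<and> card S = k} = {}"
    by (auto dest: card_mono)
  then show ?thesis unfolding esym_def by (simp only: sum.empty)
qed

lemma esym_insert:
  assumes "finite A" "i \<notin> A"
  shows "esym (insert i A) v (Suc k) = esym A v (Suc k) + v i * esym A v k"
proof -
  let ?S = "\<lambda>k. {S. S \<subseteq> A \<and> card S = k}"
  have fin: "finite (?S k)" for k using assms by simp
  have finS: "finite S" if "S \<subseteq> A" for S using that assms finite_subset by blast
  have "{S. S \<subseteq> insert i A \<and> card S = Suc k} = ?S (Suc k) \<union> insert i ` ?S k"
  proof (rule equalityI; rule subsetI)
    fix S assume S: "S \<in> {S. S \<subseteq> insert i A \<and> card S = Suc k}"
    show "S \<in> ?S (Suc k) \<union> insert i ` ?S k"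
    proof (cases "i \<in> S")
      case True
      then have "S = insert i (S - {i})" "S - {i} \<subseteq> A" "card (S - {i}) = k"
        using S by auto
      then show ?thesis by blast
    qed (use S in auto)
  next
    fix S assume "S \<in> ?S (Suc k) \<union> insert i ` ?S k"
    moreover have "card (insert i T) = Suc k" if "T \<subseteq> A" "card T = k" for T
      using that finS assms by (metis card_insert_disjoint subsetD)
    ultimately show "S \<in> {S. S \<subseteq> insert i A \<and> card S = Suc k}" by auto
  qed
  moreover have "?S (Suc k) \<inter> insert i ` ?S k = {}" using assms by auto
  moreover have "inj_on (insert i) (?S k)"
    using assms by (auto simp: inj_on_def)
  moreover have "(\<Prod>j\<in>insert i S. v j) = v i * (\<Prod>j\<in>S. v j)" if "S \<subseteq> A" for S
    using that finS assms by (subst prod.insert) auto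
  ultimately show ?thesis
    using fin by (simp add: esym_def sum.union_disjoint sum.reindex sum_distrib_left)
qed

lemma esym_remove:
  assumes "finite A" "i \<in> A"
  shows "esym A v (Suc k) = esym (A - {i}) v (Suc k) + v i * esym (A - {i}) v k"
  using esym_insert[of "A - {i}" i v k] assms by (simp only: insert_Diff finite_Diff) blast

text \<open>The coefficient of \<open>t ^ k\<close> in \<open>\<Prod>\<^sub>j\<^sub>\<noteq>\<^sub>i (1 + v\<^sub>j t) = (1 + v\<^sub>i t)\<^sup>-\<^sup>1 \<Prod>\<^sub>j (1 + v\<^sub>j t)\<close>. The left-hand side is also
  \<open>\<partial>e\<^sub>k\<^sub>+\<^sub>1 / \<partial>v\<^sub>i\<close>, so that this identity yields both the Jacobian of the elementary symmetric functions
  and Newton's identities.\<close>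

lemma esym_remove_expand:
  assumes "finite A" "i \<in> A"
  shows "esym (A - {i}) v k = (\<Sum>l\<le>k. (-1) ^ l * esym A v (k - l) * v i ^ l)"
proof (induction k)
  case 0
  show ?case using assms by (simp add: esym_0)
next
  case (Suc k)
  have "esym (A - {i}) v (Suc k) = esym A v (Suc k) - v i * esym (A - {i}) v k"
    using esym_remove[OF assms, of v k] by simp
  also have "\<dots> = esym A v (Suc k) + (\<Sum>l\<le>k. (-1) ^ Suc l * esym A v (Suc k - Suc l) * v i ^ Suc l)"
    by (simp add: Suc sum_distrib_left sum_negf mult.left_commute)
  also have "\<dots> = (\<Sum>l\<le>Suc k. (-1) ^ l * esym A v (Suc k - l) * v i ^ l)"
    by (simp only: sum.atMost_Suc_shift) simp
  finally show ?case .
qed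

text \<open>Each \<open>k\<close>-subset avoids \<open>card A - k\<close> of the indices. Truncated subtraction is harmless because
  there are no \<open>k\<close>-subsets for \<open>k > card A\<close>.\<close>

lemma sum_esym_remove:
  assumes "finite A"
  shows "(\<Sum>i\<in>A. esym (A - {i}) v k) = of_nat (card A - k) * esym A v k"
proof -
  let ?S = "{S. S \<subseteq> A \<and> card S = k}"
  have fin: "finite ?S" using assms by simp
  have "esym (A - {i}) v k = (\<Sum>S\<in>?S. if i \<in> A - S then \<Prod>i\<in>S. v i else 0)" if "i \<in> A" for i
    unfolding esym_def sum.inter_filter[OF fin, symmetric]
    by (rule sum.cong) (use that in auto)
  then have "(\<Sum>i\<in>A. esym (A - {i}) v k) = (\<Sum>i\<in>A. \<Sum>S\<in>?S. if i \<in> A - S then \<Prod>i\<in>S. v i else 0)"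
    by simp
  also have "\<dots> = (\<Sum>S\<in>?S. \<Sum>i\<in>A. if i \<in> A - S then \<Prod>i\<in>S. v i else 0)"
    by (rule sum.swap)
  also have "\<dots> = (\<Sum>S\<in>?S. of_nat (card A - k) * (\<Prod>i\<in>S. v i))"
  proof (rule sum.cong)
    fix S assume S: "S \<in> ?S"
    have "card (A - S) = card A - k" using S assms
      by (metis (mono_tags, lifting) card_Diff_subset finite_subset mem_Collect_eq)
    moreover have "{i \<in> A. i \<in> A - S} = A - S" by auto
    ultimately show "(\<Sum>i\<in>A. if i \<in> A - S then \<Prod>i\<in>S. v i else 0) = of_nat (card A - k) * (\<Prod>i\<in>S. v i)"
      using sum.inter_filter[OF assms, of "\<lambda>_. \<Prod>i\<in>S. v i" "\<lambda>i. i \<in> A - S"] by simp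
  qed simp
  finally show ?thesis by (simp add: esym_def sum_distrib_left)
qed

lemma prod_linear_eq_esym:
  assumes "finite A"
  shows "(\<Prod>i\<in>A. t - v i) = (\<Sum>k\<le>card A. (-1) ^ k * esym A v k * t ^ (card A - k))"
  using assms
proof (induction A rule: finite_induct)
  case empty
  show ?case by (simp add: esym_0)
next
  case (insert i A)
  let ?n = "card A" and ?e = "esym A v" and ?e' = "esym (insert i A) v"
  let ?P = "\<Sum>k\<le>?n. (-1) ^ k * ?e k * t ^ (?n - k)"
  have "?P * t = (\<Sum>k\<le>?n. (-1) ^ k * ?e k * t ^ (Suc ?n - k))"
    unfolding sum_distrib_right by (rule sum.cong) (auto simp: Suc_diff_le mult_ac)
  also have "\<dots> = (\<Sum>k\<le>Suc ?n. (-1) ^ k * ?e k * t ^ (Suc ?n - k))"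
    using insert.hyps by (simp add: esym_eq_0)
  also have "\<dots> = t ^ Suc ?n + (\<Sum>k\<le>?n. (-1) ^ Suc k * ?e (Suc k) * t ^ (?n - k))"
    by (simp only: sum.atMost_Suc_shift) (simp add: esym_0 insert.hyps)
  finally have Pt: "?P * t = t ^ Suc ?n + (\<Sum>k\<le>?n. (-1) ^ Suc k * ?e (Suc k) * t ^ (?n - k))" .
  have Pv: "- (?P * v i) = (\<Sum>k\<le>?n. (-1) ^ Suc k * (v i * ?e k) * t ^ (?n - k))"
    unfolding sum_distrib_right sum_negf[symmetric] by (rule sum.cong) (auto simp: mult_ac)
  have "(\<Sum>k\<le>Suc ?n. (-1) ^ k * ?e' k * t ^ (Suc ?n - k))
      = t ^ Suc ?n + (\<Sum>k\<le>?n. (-1) ^ Suc k * ?e' (Suc k) * t ^ (?n - k))"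
    by (simp only: sum.atMost_Suc_shift) (simp add: esym_0 insert.hyps)
  also have "(\<Sum>k\<le>?n. (-1) ^ Suc k * ?e' (Suc k) * t ^ (?n - k))
      = (\<Sum>k\<le>?n. (-1) ^ Suc k * ?e (Suc k) * t ^ (?n - k))
      + (\<Sum>k\<le>?n. (-1) ^ Suc k * (v i * ?e k) * t ^ (?n - k))"
    by (simp only: esym_insert[OF insert.hyps] sum.distrib[symmetric] distrib_left distrib_right)
  also have "t ^ Suc ?n + \<dots> = ?P * t + - (?P * v i)"
    unfolding Pt Pv by (simp only: add.assoc)
  also have "\<dots> = (t - v i) * ?P" by (simp add: algebra_simps)
  finally show ?case
    using insert by simp
qed

lemma esym_cong: "(\<And>i. i \<in> A \<Longrightarrow> v i = w i) \<Longrightarrow> esym A v k = esym A w k"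
  unfolding esym_def by (intro sum.cong prod.cong) auto

lemma (in comm_ring_hom) hom_esym: "hom (esym A v k) = esym A (\<lambda>i. hom (v i)) k"
  by (simp add: esym_def hom_sum hom_prod)

lemma elem_sym_eq_esym: "elem_sym p k = esym {1..p} Var k"
  by (simp add: elem_sym_def esym_def)

lemma eval_at_elem_sym: "eval_at x (elem_sym p k) = esym {1..p} x k"
  by (simp add: elem_sym_eq_esym eval_at.hom_esym)

section \<open>Points with prescribed elementary symmetric functions\<close>

text \<open>The elementary symmetric functions of \<open>x\<close> determine, and are determined by, the monic
  polynomial with roots \<open>x\<^sub>1, \<dots>, x\<^sub>p\<close>.\<close>

lemma esym_eq_iff_prod_eq:
  fixes x y :: "nat \<Rightarrow> complex"
  shows "(\<forall>k\<in>{1..p}. esym {1..p} x k = c k) \<longleftrightarrow>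
    (\<forall>t. (\<Prod>i\<in>{1..p}. t - x i) = t ^ p + (\<Sum>k\<in>{1..p}. (-1) ^ k * c k * t ^ (p - k)))"
    (is "?l \<longleftrightarrow> ?r")
proof -
  \<comment> \<open>The values \<open>c\<^sub>1, \<dots>, c\<^sub>p\<close> leave out the leading coefficient.\<close>
  define d where "d k = (if k = 0 then 1 else c k)" for k
  have rev: "(\<Sum>k\<le>p. (-1) ^ k * f k * t ^ (p - k)) = (\<Sum>i\<le>p. (-1) ^ (p - i) * f (p - i) * t ^ i)"
    for f and t :: complex
    by (rule sum.reindex_bij_witness[of _ "\<lambda>i. p - i" "\<lambda>i. p - i"]) auto
  have "(\<Sum>k\<le>p. (-1) ^ k * d k * t ^ (p - k)) = t ^ p + (\<Sum>k\<in>{1..p}. (-1) ^ k * c k * t ^ (p - k))" for t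
  proof -
    have "{..p} = insert 0 {1..p}" by auto
    then show ?thesis by (simp add: d_def)
  qed
  then have "?r \<longleftrightarrow> (\<forall>t. (\<Sum>k\<le>p. (-1) ^ k * esym {1..p} x k * t ^ (p - k)) = (\<Sum>k\<le>p. (-1) ^ k * d k * t ^ (p - k)))"
    by (simp add: prod_linear_eq_esym)
  also have "\<dots> \<longleftrightarrow> (\<forall>i\<le>p. (-1) ^ (p - i) * esym {1..p} x (p - i) = (-1) ^ (p - i) * d (p - i))"
    unfolding rev by (rule polyfun_eq_coeffs)
  also have "\<dots> \<longleftrightarrow> (\<forall>i\<le>p. esym {1..p} x (p - i) = d (p - i))" by simp
  also have "\<dots> \<longleftrightarrow> (\<forall>k\<le>p. esym {1..p} x k = d k)"
    by (metis diff_diff_cancel diff_le_self)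
  also have "\<dots> \<longleftrightarrow> ?l"
    by (auto simp: d_def esym_0 Suc_le_eq)
  finally show ?thesis by simp
qed

text \<open>By the fundamental theorem of algebra every point of \<open>\<complex>\<^sup>p\<close> is hit by the elementary symmetric
  functions.\<close>

lemma exists_esym_eq:
  fixes c :: "nat \<Rightarrow> complex"
  obtains x where "\<And>k. k \<in> {1..p} \<Longrightarrow> esym {1..p} x k = c k"
proof -
  define q where "q = monom 1 p + (\<Sum>k\<in>{1..p}. monom ((-1) ^ k * c k) (p - k))"
  have deg: "degree (\<Sum>k\<in>{1..p}. monom ((-1) ^ k * c k) (p - k)) < p" if "p > 0"
    by (rule degree_sum_less) (use that in \<open>auto intro: le_less_trans[OF degree_monom_le]\<close>)
  have dq: "degree q = p" and lq: "lead_coeff q = 1"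
  proof -
    have "degree q = p \<and> lead_coeff q = 1"
    proof (cases "p = 0")
      case False
      then have "degree q = p"
        unfolding q_def using deg by (subst degree_add_eq_left) (auto simp: degree_monom_eq)
      moreover have "coeff q p = 1" using deg False by (simp add: q_def coeff_eq_0)
      ultimately show ?thesis by simp
    qed (simp add: q_def)
    then show "degree q = p" "lead_coeff q = 1" by auto
  qed
  obtain r where r: "smult (lead_coeff q) (\<Prod>i<degree q. [:- r i, 1:]) = q"
    by (rule complex_poly_decompose')
  define x where "x i = r (i - 1)" for i
  have "(\<Prod>i\<in>{1..p}. t - x i) = t ^ p + (\<Sum>k\<in>{1..p}. (-1) ^ k * c k * t ^ (p - k))" for t
  proof -
    have "(\<Prod>i\<in>{1..p}. t - x i) = (\<Prod>i<p. t - r i)"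
      by (rule prod.reindex_bij_witness[of _ Suc "\<lambda>i. i - 1"]) (auto simp: x_def)
    also have "\<dots> = poly q t"
      using arg_cong[OF r, of "\<lambda>q. poly q t"] by (simp add: dq lq[unfolded dq] poly_prod)
    also have "\<dots> = t ^ p + (\<Sum>k\<in>{1..p}. (-1) ^ k * c k * t ^ (p - k))"
      by (simp add: q_def poly_sum poly_monom)
    finally show ?thesis .
  qed
  then show ?thesis using that esym_eq_iff_prod_eq[of p x c] by blast
qed

section \<open>Rewriting symmetric polynomials in the elementary ones\<close>

lemma vars_add: "vars (f + g) \<subseteq> vars f \<union> vars g"
  unfolding vars_def using Poly_Mapping.keys_add[of f g] by blast

lemma vars_mult: "vars (f * g) \<subseteq> vars f \<union> vars g"
proof
  fix i assume "i \<in> vars (f * g)"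
  then obtain e where "e \<in> Poly_Mapping.keys (f * g)" "i \<in> Poly_Mapping.keys e" by (auto simp: vars_def)
  then obtain a b where "a \<in> Poly_Mapping.keys f" "b \<in> Poly_Mapping.keys g" "i \<in> Poly_Mapping.keys (a + b)"
    using Poly_Mapping.keys_mult[of f g] by blast
  then show "i \<in> vars f \<union> vars g" unfolding vars_def using Poly_Mapping.keys_add[of a b] by blast
qed

lemma vars_Const [simp]: "vars (Const a) = {}"
  by (simp add: vars_def Const_def)

lemma vars_Var [simp]: "vars (Var i) = {i}"
  by (simp add: vars_def Var_def)

lemma vars_uminus [simp]: "vars (- f) = vars f"
  by (simp add: vars_def)

lemma vars_diff: "vars (f - g) \<subseteq> vars f \<union> vars g"
  using vars_add[of f "- g"] by simp

lemma eval_at_cong: "(\<And>i. i \<in> vars g \<Longrightarrow> x i = y i) \<Longrightarrow> eval_at x g = eval_at y g"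
  unfolding eval_at_def eval_poly_with_def
  by (intro sum.cong refl arg_cong2[of _ _ _ _ "(*)"] prod.cong arg_cong2[of _ _ _ _ "(^)"]) (auto simp: vars_def)

text \<open>The image of \<open>\<complex>[c\<^sub>1, \<dots>, c\<^sub>p]\<close> in \<open>\<complex>[x\<^sub>1, \<dots>, x\<^sub>p]\<close>. That this subring contains the power sums and the
  Schur polynomials is proved directly, without the fundamental theorem of symmetric polynomials.\<close>

definition in_elems :: "nat \<Rightarrow> cpoly \<Rightarrow> bool" where
  "in_elems p f \<longleftrightarrow> (\<exists>g. vars g \<subseteq> {1..p} \<and> substitute (elem_sym p) g = f)"

lemma in_elems_Const: "in_elems p (Const a)"
  unfolding in_elems_def by (rule exI[of _ "Const a"]) simp

lemma in_elems_add: "in_elems p f \<Longrightarrow> in_elems p g \<Longrightarrow> in_elems p (f + g)"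
proof -
  assume "in_elems p f" "in_elems p g"
  then obtain f' g' where "vars f' \<subseteq> {1..p}" "vars g' \<subseteq> {1..p}"
      "substitute (elem_sym p) f' = f" "substitute (elem_sym p) g' = g"
    unfolding in_elems_def by blast
  then show ?thesis
    unfolding in_elems_def using vars_add[of f' g']
    by (intro exI[of _ "f' + g'"]) (auto simp only: substitute.hom_add)
qed

lemma in_elems_mult: "in_elems p f \<Longrightarrow> in_elems p g \<Longrightarrow> in_elems p (f * g)"
proof -
  assume "in_elems p f" "in_elems p g"
  then obtain f' g' where "vars f' \<subseteq> {1..p}" "vars g' \<subseteq> {1..p}"
      "substitute (elem_sym p) f' = f" "substitute (elem_sym p) g' = g"
    unfolding in_elems_def by blast
  then show ?thesis
    unfolding in_elems_def using vars_mult[of f' g']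
    by (intro exI[of _ "f' * g'"]) (auto simp only: substitute.hom_mult)
qed

lemma Const_1: "Const 1 = 1" and Const_0: "Const 0 = 0"
  by (simp_all add: Const_def)

lemma Const_uminus: "Const (- a) = - Const a"
  by (simp add: Const_def single_uminus)

lemma in_elems_1: "in_elems p 1" and in_elems_0: "in_elems p 0" and in_elems_neg_1: "in_elems p (- 1)"
  using in_elems_Const[of p 1] in_elems_Const[of p 0] in_elems_Const[of p "- 1"]
  by (simp_all add: Const_1 Const_0 Const_uminus)

lemma in_elems_uminus: "in_elems p f \<Longrightarrow> in_elems p (- f)"
  using in_elems_mult[OF in_elems_neg_1] by simp

lemma in_elems_sum: "(\<And>i. i \<in> A \<Longrightarrow> in_elems p (f i)) \<Longrightarrow> in_elems p (sum f A)"
  by (induction A rule: infinite_finite_induct) (auto intro: in_elems_0 in_elems_add)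

lemma in_elems_prod: "(\<And>i. i \<in> A \<Longrightarrow> in_elems p (f i)) \<Longrightarrow> in_elems p (prod f A)"
  by (induction A rule: infinite_finite_induct) (auto intro: in_elems_1 in_elems_mult)

lemma in_elems_power: "in_elems p f \<Longrightarrow> in_elems p (f ^ k)"
  by (induction k) (auto intro: in_elems_1 in_elems_mult)

lemma in_elems_det:
  assumes "A \<in> carrier_mat n n" "\<And>i j. i < n \<Longrightarrow> j < n \<Longrightarrow> in_elems p (A $$ (i, j))"
  shows "in_elems p (det A)"
proof -
  have sg: "in_elems p (signof \<pi>)" for \<pi> :: "nat \<Rightarrow> nat"
    by (auto simp: sign_def in_elems_1 in_elems_neg_1)
  show ?thesis
    unfolding det_def'[OF assms(1)]
    by (intro in_elems_sum in_elems_mult in_elems_prod sg assms(2)) (auto simp: permutes_in_image)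
qed

lemma in_elems_elem_sym: "in_elems p (elem_sym p k)"
proof -
  consider "k = 0" | "k \<in> {1..p}" | "k > p" by force
  then show ?thesis
  proof cases
    case 1
    then show ?thesis by (simp add: elem_sym_eq_esym esym_0 in_elems_1)
  next
    case 2
    then show ?thesis unfolding in_elems_def by (intro exI[of _ "Var k"]) simp
  next
    case 3
    then show ?thesis by (simp add: elem_sym_eq_esym esym_eq_0 in_elems_0)
  qed
qed

text \<open>Algebraic independence of the elementary symmetric polynomials: a relation between them would
  vanish at all their values, which fill \<open>\<complex>\<^sup>p\<close>.\<close>

lemma substitute_elem_sym_inject:
  assumes "vars f \<subseteq> {1..p}" "vars g \<subseteq> {1..p}" "substitute (elem_sym p) f = substitute (elem_sym p) g"
  shows "f = g"
proof -
  have vars: "vars (f - g) \<subseteq> {1..p}" using assms vars_diff by blast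
  have "eval_at c (f - g) = 0" for c
  proof -
    obtain x where x: "\<And>k. k \<in> {1..p} \<Longrightarrow> esym {1..p} x k = c k"
      using exists_esym_eq[of p c] by auto
    have "eval_at c (f - g) = eval_at (\<lambda>k. eval_at x (elem_sym p k)) (f - g)"
      by (rule eval_at_cong) (use vars x in \<open>auto simp: eval_at_elem_sym subset_iff\<close>)
    also have "\<dots> = eval_at x (substitute (elem_sym p) f - substitute (elem_sym p) g)"
      by (simp add: eval_at_substitute[symmetric] substitute.hom_minus)
    finally show ?thesis using assms(3) by simp
  qed
  from cpoly_eq_0_if_eval_0[OF vars this] show ?thesis by simp
qed

lemma in_elem_sym:
  assumes "in_elems p f"
  shows vars_in_elem_sym: "vars (in_elem_sym p f) \<subseteq> {1..p}"
    and substitute_in_elem_sym: "substitute (elem_sym p) (in_elem_sym p f) = f"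
proof -
  obtain g where g: "vars g \<subseteq> {1..p} \<and> substitute (elem_sym p) g = f"
    using assms by (auto simp: in_elems_def)
  have "vars (in_elem_sym p f) \<subseteq> {1..p} \<and> substitute (elem_sym p) (in_elem_sym p f) = f"
    unfolding in_elem_sym_def
    by (rule theI[of _ g]) (use g substitute_elem_sym_inject in blast)+
  then show "vars (in_elem_sym p f) \<subseteq> {1..p}" "substitute (elem_sym p) (in_elem_sym p f) = f" by auto
qed

text \<open>Newton's identities express \<open>P\<^sub>k\<close> through \<open>P\<^sub>0, \<dots>, P\<^sub>k\<^sub>-\<^sub>1\<close> and the elementary symmetric
  polynomials.\<close>

lemma in_elems_power_sum: "in_elems p (power_sum p k)"
proof (induction k rule: less_induct)
  case (less k)
  have "of_nat (p - k) * elem_sym p k = (\<Sum>i\<in>{1..p}. \<Sum>l\<le>k. (-1) ^ l * elem_sym p (k - l) * Var i ^ l)"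
    using sum_esym_remove[of "{1..p}" "Var :: nat \<Rightarrow> cpoly" k]
    by (simp add: elem_sym_eq_esym esym_remove_expand)
  also have "\<dots> = (\<Sum>l\<le>k. (-1) ^ l * elem_sym p (k - l) * power_sum p l)"
    by (subst sum.swap) (simp add: power_sum_def sum_distrib_left)
  also have "\<dots> = (\<Sum>l<k. (-1) ^ l * elem_sym p (k - l) * power_sum p l) + (-1) ^ k * power_sum p k"
    by (simp add: lessThan_Suc_atMost[symmetric] elem_sym_eq_esym esym_0)
  finally have "(-1) ^ k * power_sum p k
      = of_nat (p - k) * elem_sym p k - (\<Sum>l<k. (-1) ^ l * elem_sym p (k - l) * power_sum p l)"
    by simp
  then have "(-1) ^ k * ((-1) ^ k * power_sum p k)
      = (-1) ^ k * (of_nat (p - k) * elem_sym p k + - (\<Sum>l<k. (-1) ^ l * elem_sym p (k - l) * power_sum p l))"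
    by simp
  then have eq: "power_sum p k
      = (-1) ^ k * (of_nat (p - k) * elem_sym p k + - (\<Sum>l<k. (-1) ^ l * elem_sym p (k - l) * power_sum p l))"
    by (simp add: mult.assoc[symmetric] power_add[symmetric])
  have nat: "in_elems p (of_nat a)" for a
    by (induction a) (auto intro: in_elems_0 in_elems_1 in_elems_add)
  show ?case
    by (subst eq, intro in_elems_mult in_elems_power in_elems_neg_1 in_elems_add nat in_elems_uminus
        in_elems_sum in_elems_elem_sym less) auto
qed

section \<open>Alternants and Schur polynomials\<close>

definition alt :: "nat \<Rightarrow> (nat \<Rightarrow> complex) \<Rightarrow> (nat \<Rightarrow> nat) \<Rightarrow> complex" where
  "alt p x \<mu> = det (mat p p (\<lambda>(i, j). x (i + 1) ^ \<mu> (j + 1)))"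

lemma eval_at_alternant: "eval_at x (alternant p \<mu>) = alt p x \<mu>"
proof -
  have "map_mat (eval_at x) (mat p p (\<lambda>(i, j). Var (i + 1) ^ \<mu> (j + 1)))
      = mat p p (\<lambda>(i, j). x (i + 1) ^ \<mu> (j + 1))"
    by (rule eq_matI) (auto simp: eval_at.hom_power)
  then show ?thesis
    using eval_at.hom_det[of x "mat p p (\<lambda>(i, j). Var (i + 1) ^ \<mu> (j + 1))"]
    by (simp add: alternant_def alt_def)
qed

text \<open>A linear dependence between the columns would be a nonzero polynomial of degree less than \<open>p\<close>
  with the \<open>p\<close> roots \<open>x\<^sub>1, \<dots>, x\<^sub>p\<close>.\<close>

lemma alt_vandermonde_nonzero:
  assumes inj: "inj_on x {1..p}"
  shows "alt p x (\<lambda>j. p - j) \<noteq> 0"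
proof
  let ?V = "mat p p (\<lambda>(i, j). x (i + 1) ^ (p - (j + 1)))"
  assume "alt p x (\<lambda>j. p - j) = 0"
  then have "det ?V = 0" by (simp add: alt_def)
  then obtain v where v: "v \<in> carrier_vec p" "v \<noteq> 0\<^sub>v p" "?V *\<^sub>v v = 0\<^sub>v p"
    using det_0_iff_vec_prod_zero[of ?V p] by auto
  then obtain k where k: "k < p" "v $ k \<noteq> 0"
    by (metis carrier_vecD eq_vecI index_zero_vec)
  define c where "c l = v $ (p - 1 - l)" for l
  have p: "{..p - 1} = {..<p}" using k(1) by auto
  have root: "(\<Sum>l\<le>p - 1. c l * x i ^ l) = 0" if "i \<in> {1..p}" for i
  proof -
    have "0 = (?V *\<^sub>v v) $ (i - 1)" using v(3) that by auto
    also have "\<dots> = (\<Sum>j<p. x i ^ (p - (j + 1)) * v $ j)"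
      using that v(1) by (auto simp: scalar_prod_def atLeast0LessThan)
    also have "\<dots> = (\<Sum>l<p. c l * x i ^ l)"
      by (rule sum.reindex_bij_witness[of _ "\<lambda>l. p - 1 - l" "\<lambda>l. p - 1 - l"]) (auto simp: c_def)
    finally show ?thesis unfolding p by simp
  qed
  have "c (p - 1 - k) \<noteq> 0" "p - 1 - k \<le> p - 1" using k by (auto simp: c_def)
  from polyfun_rootbound[of c, OF this]
  have fin: "finite {z. (\<Sum>l\<le>p - 1. c l * z ^ l) = 0}" "card {z. (\<Sum>l\<le>p - 1. c l * z ^ l) = 0} \<le> p - 1"
    by auto
  have sub: "x ` {1..p} \<subseteq> {z. (\<Sum>l\<le>p - 1. c l * z ^ l) = 0}" using root by blast
  have "card (x ` {1..p}) \<le> p - 1" using card_mono[OF fin(1) sub] fin(2) by linarith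
  moreover have "card (x ` {1..p}) = p" by (simp only: card_image[OF inj] card_atLeastAtMost diff_Suc_1)
  ultimately show False using k(1) by linarith
qed

lemma alternant_nonzero: "alternant p (\<lambda>j. p - j) \<noteq> 0"
proof
  assume "alternant p (\<lambda>j. p - j) = 0"
  then have "alt p of_nat (\<lambda>j. p - j) = 0" using eval_at_alternant[of of_nat p "\<lambda>j. p - j"] by simp
  moreover have "inj_on (of_nat :: nat \<Rightarrow> complex) {1..p}" by (auto simp: inj_on_def)
  ultimately show False using alt_vandermonde_nonzero by blast
qed

text \<open>The remainder of \<open>X ^ l\<close> modulo \<open>\<Prod>\<^sub>j (X - x\<^sub>j)\<close>, evaluated at each root \<open>x\<^sub>i\<close>. Its coefficients are the
  same for all \<open>i\<close> and involve only the coefficients of the modulus.\<close>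

lemma Var_power_reduction:
  assumes "p \<ge> 1"
  shows "\<exists>r. (\<forall>k. in_elems p (r k)) \<and> (\<forall>i\<in>{1..p}. Var i ^ l = (\<Sum>k<p. Var i ^ (p - 1 - k) * r k))"
proof -
  define s where "s k = (-1) ^ k * elem_sym p (k + 1)" for k
  have s: "Var i ^ p = (\<Sum>k<p. Var i ^ (p - 1 - k) * s k)" if "i \<in> {1..p}" for i
  proof -
    have "0 = (\<Prod>j\<in>{1..p}. Var i - Var j :: cpoly)" using that by (auto intro!: prod_zero[symmetric])
    also have "\<dots> = (\<Sum>k\<le>p. (-1) ^ k * elem_sym p k * Var i ^ (p - k))"
      by (simp add: prod_linear_eq_esym elem_sym_eq_esym)
    also have "\<dots> = Var i ^ p + (\<Sum>k<p. (-1) ^ Suc k * elem_sym p (Suc k) * Var i ^ (p - Suc k))"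
      by (simp only: sum.atMost_shift) (simp add: elem_sym_eq_esym esym_0)
    also have "(\<Sum>k<p. (-1) ^ Suc k * elem_sym p (Suc k) * Var i ^ (p - Suc k))
        = - (\<Sum>k<p. Var i ^ (p - 1 - k) * s k)"
      unfolding sum_negf[symmetric] by (rule sum.cong) (auto simp: s_def mult_ac)
    finally show ?thesis by simp
  qed
  have sin: "in_elems p (s k)" for k
    unfolding s_def by (intro in_elems_mult in_elems_power in_elems_neg_1 in_elems_elem_sym)
  obtain p' where p': "p = Suc p'" using assms by (cases p) auto
  show ?thesis
  proof (induction l)
    case 0
    let ?r = "\<lambda>k. if k = p' then 1 else (0::cpoly)"
    have "(\<Sum>k<p. Var i ^ (p - 1 - k) * ?r k) = 1" for i
    proof -
      have "(\<Sum>k<p. Var i ^ (p - 1 - k) * ?r k) = (\<Sum>k<p. if k = p' then 1 else 0)"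
        by (rule sum.cong) (auto simp: p')
      then show ?thesis by (simp add: p')
    qed
    then show ?case by (intro exI[of _ ?r]) (auto simp: in_elems_0 in_elems_1)
  next
    case (Suc l)
    then obtain r where r: "\<And>k. in_elems p (r k)"
      "\<And>i. i \<in> {1..p} \<Longrightarrow> Var i ^ l = (\<Sum>k<p. Var i ^ (p - 1 - k) * r k)" by blast
    define r' where "r' k = s k * r 0 + (if k < p' then r (Suc k) else 0)" for k
    have "Var i ^ Suc l = (\<Sum>k<p. Var i ^ (p - 1 - k) * r' k)" if i: "i \<in> {1..p}" for i
    proof -
      let ?x = "Var i"
      have "?x ^ Suc l = ?x * (?x ^ p' * r 0 + (\<Sum>k<p'. ?x ^ (p' - Suc k) * r (Suc k)))"
        by (simp add: r(2)[OF i] p' sum.lessThan_Suc_shift del: sum.lessThan_Suc)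
      also have "\<dots> = ?x ^ p * r 0 + (\<Sum>k<p'. ?x * (?x ^ (p' - Suc k) * r (Suc k)))"
        by (simp add: distrib_left sum_distrib_left p' mult.assoc)
      also have "(\<Sum>k<p'. ?x * (?x ^ (p' - Suc k) * r (Suc k))) = (\<Sum>k<p'. ?x ^ (p' - k) * r (Suc k))"
        by (rule sum.cong) (auto simp: mult.assoc[symmetric] power_Suc[symmetric] Suc_diff_Suc simp del: power_Suc)
      also have "\<dots> = (\<Sum>k<p. ?x ^ (p - 1 - k) * (if k < p' then r (Suc k) else 0))"
        by (simp add: p')
      also have "?x ^ p * r 0 = (\<Sum>k<p. ?x ^ (p - 1 - k) * (s k * r 0))"
        by (simp only: s[OF i] sum_distrib_right mult.assoc)
      also have "\<dots> + (\<Sum>k<p. ?x ^ (p - 1 - k) * (if k < p' then r (Suc k) else 0))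
          = (\<Sum>k<p. ?x ^ (p - 1 - k) * r' k)"
        unfolding sum.distrib[symmetric] r'_def by (simp only: distrib_left)
      finally show ?thesis .
    qed
    moreover have "in_elems p (r' k)" for k
      unfolding r'_def by (auto intro!: in_elems_add in_elems_mult sin r in_elems_0)
    ultimately show ?case by blast
  qed
qed

text \<open>By reduction of powers, the matrix of an alternant is the Vandermonde matrix times the matrix
  of remainder coefficients, so the quotient of alternants is the determinant of the latter.\<close>

lemma exists_schur:
  assumes "p \<ge> 1"
  shows "\<exists>s. in_elems p s \<and> s * alternant p (\<lambda>j. p - j) = alternant p \<mu>"
proof -
  obtain r where r: "\<And>l k. in_elems p (r l k)"
    "\<And>l i. i \<in> {1..p} \<Longrightarrow> Var i ^ l = (\<Sum>k<p. Var i ^ (p - 1 - k) * r l k)"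
    using Var_power_reduction[OF assms] by metis
  define R where "R = mat p p (\<lambda>(k, j). r (\<mu> (j + 1)) k)"
  let ?V = "\<lambda>\<mu>. mat p p (\<lambda>(i, j). Var (i + 1) ^ \<mu> (j + 1))"
  have "?V \<mu> = ?V (\<lambda>j. p - j) * R"
  proof (rule eq_matI)
    fix i j assume "i < dim_row (?V (\<lambda>j. p - j) * R)" "j < dim_col (?V (\<lambda>j. p - j) * R)"
    then have ij: "i < p" "j < p" by (auto simp: R_def)
    have "Var (i + 1) ^ \<mu> (j + 1) = (\<Sum>k<p. Var (i + 1) ^ (p - 1 - k) * r (\<mu> (j + 1)) k)"
      by (rule r(2)) (use ij in auto)
    then show "?V \<mu> $$ (i, j) = (?V (\<lambda>j. p - j) * R) $$ (i, j)"
      using ij by (simp add: R_def scalar_prod_def atLeast0LessThan)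
  qed (auto simp: R_def)
  then have "alternant p \<mu> = alternant p (\<lambda>j. p - j) * det R"
    unfolding alternant_def by (simp only:) (rule det_mult, auto simp: R_def)
  moreover have "in_elems p (det R)"
    by (rule in_elems_det[of _ p]) (auto simp: R_def r(1))
  ultimately show ?thesis by (intro exI[of _ "det R"]) (simp add: mult.commute)
qed

lemma schur:
  assumes "p \<ge> 1"
  shows in_elems_schur: "in_elems p (schur p l)"
    and schur_times_alternant: "schur p l * alternant p (\<lambda>j. p - j) = alternant p (\<lambda>j. l j + p - j)"
proof -
  obtain s where s: "in_elems p s" "s * alternant p (\<lambda>j. p - j) = alternant p (\<lambda>j. l j + p - j)"
    using exists_schur[OF assms] by blast
  have "schur p l = s" unfolding schur_def
  proof (rule the_equality)
    show "s * alternant p (\<lambda>j. p - j) = alternant p (\<lambda>j. l j + p - j)" by (rule s(2))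
    fix t assume "t * alternant p (\<lambda>j. p - j) = alternant p (\<lambda>j. l j + p - j)"
    then have "t * alternant p (\<lambda>j. p - j) = s * alternant p (\<lambda>j. p - j)" by (simp only: s(2))
    then show "t = s" using mult_right_cancel[OF alternant_nonzero[of p]] by blast
  qed
  with s show "in_elems p (schur p l)"
    "schur p l * alternant p (\<lambda>j. p - j) = alternant p (\<lambda>j. l j + p - j)" by auto
qed

section \<open>Gradient and Hessian of the potential\<close>

lemma pdiff_uminus: "pdiff j (- f) = - pdiff j f"
proof -
  have "pdiff j f + pdiff j (- f) = 0" using pdiff_add[of j f "- f"] by simp
  then show ?thesis by (simp add: eq_neg_iff_add_eq_0 add.commute)
qed

lemma pdiff_neg_1_power [simp]: "pdiff j ((- 1) ^ k) = 0"
  by (cases "even k") (simp_all add: pdiff_uminus)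

lemma of_nat_eq_Const: "of_nat k = Const (of_nat k)"
  by (induction k) (simp_all add: Const_def single_add)

lemma pdiff_esym_other:
  assumes "finite A" "i \<notin> A"
  shows "pdiff i (esym A Var k) = 0"
proof -
  have "pdiff i (\<Prod>j\<in>S. Var j) = 0" if "finite S" "i \<notin> S" for S
    using that by (induction S) (auto simp: pdiff_Var_times)
  then show ?thesis
    unfolding esym_def pdiff_sum using assms finite_subset
    by (intro sum.neutral) blast
qed

lemma pdiff_elem_sym:
  assumes "i \<in> {1..p}"
  shows "pdiff i (elem_sym p (Suc k)) = esym ({1..p} - {i}) Var k"
  unfolding elem_sym_eq_esym esym_remove[OF finite_atLeastAtMost assms]
  by (simp add: pdiff_add pdiff_Var_times pdiff_esym_other)

lemma pdiff_elem_sym_outside: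
  assumes "j \<notin> {1..p}"
  shows "pdiff i (elem_sym p j) = 0"
  using assms by (cases "j = 0") (auto simp: elem_sym_eq_esym esym_0 esym_eq_0)

lemma esym_remove_diff:
  assumes "finite A" "i \<in> A" "j \<in> A" "i \<noteq> j"
  shows "esym (A - {i}) v (Suc k) - esym (A - {j}) v (Suc k) = (v j - v i) * esym (A - {i, j}) v k"
proof -
  have e: "A - {i} - {j} = A - {i, j}" "A - {j} - {i} = A - {i, j}" by auto
  have "esym (A - {i}) v (Suc k) = esym (A - {i, j}) v (Suc k) + v j * esym (A - {i, j}) v k"
    using esym_remove[of "A - {i}" j v k] assms unfolding e by simp
  moreover have "esym (A - {j}) v (Suc k) = esym (A - {i, j}) v (Suc k) + v i * esym (A - {i, j}) v k"
    using esym_remove[of "A - {j}" i v k] assms unfolding e by simp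
  ultimately show ?thesis by (simp add: left_diff_distrib)
qed

text \<open>The partial derivatives \<open>\<partial>QW / \<partial>c\<^sub>j\<close>, pulled back to polynomials in the \<open>x\<^sub>i\<close>.\<close>

definition QW_grad :: "nat \<Rightarrow> nat \<Rightarrow> nat \<Rightarrow> cpoly" where
  "QW_grad m p j = substitute (elem_sym p) (pdiff j (QW m p))"

lemma substitute_QW:
  assumes "p \<ge> 1"
  shows "substitute (elem_sym p) (QW m p)
    = Const (1 / of_nat (m + p + 1)) * power_sum p (m + p + 1) + (- 1) ^ p * elem_sym p 1"
  by (simp add: QW_def substitute.hom_add substitute.hom_mult substitute.hom_power substitute.hom_uminus
      substitute_in_elem_sym in_elems_power_sum)

text \<open>The chain rule for \<open>QW(e\<^sub>1(x), \<dots>, e\<^sub>p(x)) = P\<^sub>n\<^sub>+\<^sub>1 / (n + 1) + (-1) ^ p e\<^sub>1\<close>. It holds as an identity of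
  polynomials, so it may still be divided by differences \<open>x\<^sub>i - x\<^sub>j\<close>.\<close>

lemma grad_identity:
  assumes p: "p \<ge> 1" and i: "i \<in> {1..p}"
  shows "Var i ^ (m + p) + (- 1) ^ p = (\<Sum>j\<in>{1..p}. QW_grad m p j * pdiff i (elem_sym p j))"
proof -
  have "(\<Sum>j\<in>{1..p}. QW_grad m p j * pdiff i (elem_sym p j)) = pdiff i (substitute (elem_sym p) (QW m p))"
    unfolding QW_grad_def by (rule pdiff_substitute[symmetric]) (auto intro: pdiff_elem_sym_outside)
  also have "\<dots> = Const (1 / of_nat (m + p + 1)) * pdiff i (power_sum p (m + p + 1)) + (- 1) ^ p"
    using pdiff_elem_sym[OF i, of 0]
    by (simp add: substitute_QW[OF p] pdiff_add pdiff_Const_times pdiff_mult[of _ "(- 1) ^ p"] esym_0)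
  also have "pdiff i (power_sum p (m + p + 1)) = of_nat (m + p + 1) * Var i ^ (m + p)"
    using i by (simp add: power_sum_def pdiff_sum pdiff_Var_power sum.delta del: power_Suc)
  also have "Const (1 / of_nat (m + p + 1)) * (of_nat (m + p + 1) * Var i ^ (m + p)) = Var i ^ (m + p)"
  proof -
    have "Const (1 / of_nat (m + p + 1)) * of_nat (m + p + 1) = 1"
      unfolding of_nat_eq_Const Const_1[symmetric] unfolding Const_def mult_single
      by (simp del: of_nat_add of_nat_Suc)
    then show ?thesis by (simp only: mult.assoc[symmetric] mult_1_left)
  qed
  finally show ?thesis by simp
qed

text \<open>The derivative of the previous identity. At critical points the terms with second derivatives
  of the \<open>e\<^sub>j\<close> disappear, and what remains is a congruence transformation of the Hessian.\<close>

lemma hessian_identity: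
  assumes p: "p \<ge> 1" and i: "i \<in> {1..p}"
  shows "(if i = l then of_nat (m + p) * Var i ^ (m + p - 1) else 0)
    = (\<Sum>j\<in>{1..p}. (\<Sum>k\<in>{1..p}. substitute (elem_sym p) (pdiff k (pdiff j (QW m p)))
          * pdiff l (elem_sym p k)) * pdiff i (elem_sym p j)
        + QW_grad m p j * pdiff l (pdiff i (elem_sym p j)))"
proof -
  have chain: "pdiff l (QW_grad m p j) = (\<Sum>k\<in>{1..p}. substitute (elem_sym p) (pdiff k (pdiff j (QW m p)))
          * pdiff l (elem_sym p k))" for j
    unfolding QW_grad_def by (rule pdiff_substitute) (auto intro: pdiff_elem_sym_outside)
  have "(if i = l then of_nat (m + p) * Var i ^ (m + p - 1) else 0) = pdiff l (Var i ^ (m + p) + (- 1) ^ p)"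
    by (simp add: pdiff_add pdiff_Var_power)
  also have "\<dots> = (\<Sum>j\<in>{1..p}. pdiff l (QW_grad m p j) * pdiff i (elem_sym p j)
      + QW_grad m p j * pdiff l (pdiff i (elem_sym p j)))"
    by (simp only: grad_identity[OF p i] pdiff_sum pdiff_mult)
  finally show ?thesis by (simp only: chain)
qed

lemma vars_pdiff: "vars (pdiff j f) \<subseteq> vars f"
proof
  fix i assume "i \<in> vars (pdiff j f)"
  then obtain e' where e': "e' \<in> Poly_Mapping.keys (pdiff j f)" "i \<in> Poly_Mapping.keys e'"
    unfolding vars_def by blast
  have "Poly_Mapping.keys (pdiff j f) \<subseteq> (\<Union>e\<in>Poly_Mapping.keys f.
      Poly_Mapping.keys (Poly_Mapping.single (e - Poly_Mapping.single j 1)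
       (of_nat (Poly_Mapping.lookup e j) * Poly_Mapping.lookup f e)))"
    unfolding pdiff_def by (rule Poly_Mapping.keys_sum)
  then obtain e where e: "e \<in> Poly_Mapping.keys f" "e' = e - Poly_Mapping.single j 1"
    using e'(1) by (auto split: if_splits)
  then have "i \<in> Poly_Mapping.keys e" using e'(2) by (auto simp: in_keys_iff lookup_minus)
  then show "i \<in> vars f" using e unfolding vars_def by blast
qed

lemma vars_1 [simp]: "vars 1 = {}"
  using vars_Const[of 1] by (simp only: Const_1)

lemma vars_QW: "p \<ge> 1 \<Longrightarrow> vars (QW m p) \<subseteq> {1..p}"
proof -
  assume p: "p \<ge> 1"
  have "vars ((- 1) ^ p :: cpoly) = {}" by (cases "even p") simp_all
  then have "vars ((- 1) ^ p * Var 1) \<subseteq> {1..p}" using vars_mult[of "(- 1) ^ p" "Var 1"] p by auto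
  moreover have "vars (Const (1 / of_nat (m + p + 1)) * in_elem_sym p (power_sum p (m + p + 1))) \<subseteq> {1..p}"
    using vars_mult[of "Const (1 / of_nat (m + p + 1))" "in_elem_sym p (power_sum p (m + p + 1))"]
      vars_in_elem_sym[OF in_elems_power_sum, of p "m + p + 1"] by (simp only: vars_Const) blast
  ultimately show ?thesis
    unfolding QW_def
    using vars_add[of "Const (1 / of_nat (m + p + 1)) * in_elem_sym p (power_sum p (m + p + 1))" "(- 1) ^ p * Var 1"]
    by blast
qed

definition elem_point :: "nat \<Rightarrow> (nat \<Rightarrow> complex) \<Rightarrow> nat \<Rightarrow> complex" where
  "elem_point p x = restrict (esym {1..p} x) {1..p}"

lemma eval_at_elem_point:
  assumes "vars g \<subseteq> {1..p}"
  shows "eval_at (elem_point p x) g = eval_at x (substitute (elem_sym p) g)"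
  unfolding eval_at_substitute
  by (rule eval_at_cong) (use assms in \<open>auto simp: elem_point_def eval_at_elem_sym\<close>)

lemma eval_at_QW_grad:
  "p \<ge> 1 \<Longrightarrow> eval_at (elem_point p x) (pdiff j (QW m p)) = eval_at x (QW_grad m p j)"
  unfolding QW_grad_def
  by (rule eval_at_elem_point) (use vars_pdiff vars_QW in blast)

lemma sum_atLeast1_shift: "(\<Sum>j\<in>{1..p::nat}. f j) = (\<Sum>j<p. f (j + 1))"
  by (rule sum.reindex_bij_witness[of _ Suc "\<lambda>j. j - 1"]) auto

definition jacobian :: "nat \<Rightarrow> (nat \<Rightarrow> complex) \<Rightarrow> complex mat" where
  "jacobian p x = mat p p (\<lambda>(i, j). eval_at x (pdiff (i + 1) (elem_sym p (j + 1))))"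

text \<open>By \<open>esym_remove_expand\<close> the Jacobian is the matrix \<open>(x\<^sub>i ^ l)\<close> times an upper triangular matrix
  with diagonal entries \<open>\<plusminus>1\<close>. Squares avoid tracking signs, and only the square enters the Hessian.\<close>

lemma det_jacobian_squared: "(det (jacobian p x))\<^sup>2 = (alt p x (\<lambda>j. p - j))\<^sup>2"
proof -
  define V where "V = mat p p (\<lambda>(i, j). x (i + 1) ^ (p - (j + 1)))"
  \<comment> \<open>\<open>P\<close> reverses the order of the columns, which run from \<open>x ^ (p - 1)\<close> down to \<open>1\<close> in \<open>V\<close>.\<close>
  define P where "P = mat p p (\<lambda>(k, l). if k = p - 1 - l then 1 else (0::complex))"
  define U where "U = mat p p (\<lambda>(l, j). if l \<le> j then (-1) ^ l * esym {1..p} x (j - l) else 0)"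
  have carr: "V \<in> carrier_mat p p" "P \<in> carrier_mat p p" "U \<in> carrier_mat p p"
    by (simp_all add: V_def P_def U_def)
  have PP: "P * P = 1\<^sub>m p"
  proof (rule eq_matI)
    fix i j assume "i < dim_row (1\<^sub>m p :: complex mat)" "j < dim_col (1\<^sub>m p :: complex mat)"
    then have ij: "i < p" "j < p" by auto
    have "(\<Sum>k<p. (if i = p - 1 - k then 1 else 0) * (if k = p - 1 - j then 1 else (0::complex)))
        = (\<Sum>k<p. if k = p - 1 - j then (if i = j then 1 else 0) else 0)"
      by (rule sum.cong) (use ij in auto)
    also have "\<dots> = (if i = j then 1 else 0)" using ij by simp
    finally show "(P * P) $$ (i, j) = 1\<^sub>m p $$ (i, j)"
      using ij by (simp add: P_def scalar_prod_def atLeast0LessThan)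
  qed (auto simp: P_def)
  have VP: "V * P = mat p p (\<lambda>(i, l). x (i + 1) ^ l)"
  proof (rule eq_matI)
    fix i l assume "i < dim_row (mat p p (\<lambda>(i, l). x (i + 1) ^ l))" "l < dim_col (mat p p (\<lambda>(i, l). x (i + 1) ^ l))"
    then have il: "i < p" "l < p" by auto
    have "(\<Sum>k<p. x (i + 1) ^ (p - (k + 1)) * (if k = p - 1 - l then 1 else 0))
        = (\<Sum>k<p. if k = p - 1 - l then x (i + 1) ^ l else 0)"
      by (rule sum.cong) (use il in auto)
    also have "\<dots> = x (i + 1) ^ l" using il by simp
    finally show "(V * P) $$ (i, l) = mat p p (\<lambda>(i, l). x (i + 1) ^ l) $$ (i, l)"
      using il by (simp add: V_def P_def scalar_prod_def atLeast0LessThan)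
  qed (auto simp: V_def P_def)
  have "jacobian p x = V * P * U"
  proof (rule eq_matI)
    fix i j assume "i < dim_row (V * P * U)" "j < dim_col (V * P * U)"
    then have ij: "i < p" "j < p" by (auto simp: V_def U_def)
    then have i: "Suc i \<in> {1..p}" by auto
    have "jacobian p x $$ (i, j) = esym ({1..p} - {Suc i}) x j"
      using ij pdiff_elem_sym[OF i, of j] by (simp add: jacobian_def eval_at.hom_esym)
    also have "\<dots> = (\<Sum>l\<le>j. (-1) ^ l * esym {1..p} x (j - l) * x (Suc i) ^ l)"
      by (rule esym_remove_expand) (use i in auto)
    also have "\<dots> = (\<Sum>l<p. if l \<le> j then (-1) ^ l * esym {1..p} x (j - l) * x (Suc i) ^ l else 0)"
      by (rule sum.mono_neutral_cong_left) (use ij in auto)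
    also have "\<dots> = (\<Sum>l<p. x (Suc i) ^ l * (if l \<le> j then (-1) ^ l * esym {1..p} x (j - l) else 0))"
      by (rule sum.cong) auto
    also have "\<dots> = (V * P * U) $$ (i, j)"
      unfolding VP using ij by (simp add: U_def scalar_prod_def atLeast0LessThan)
    finally show "jacobian p x $$ (i, j) = (V * P * U) $$ (i, j)" .
  qed (auto simp: V_def U_def jacobian_def)
  moreover have "det (V * P * U) = det (V * P) * det U"
    by (rule det_mult[of _ p]) (use carr in auto)
  moreover have "det (V * P) = det V * det P"
    by (rule det_mult[of _ p]) (use carr in auto)
  moreover have "det V = alt p x (\<lambda>j. p - j)" by (simp add: V_def alt_def)
  ultimately have "det (jacobian p x) = alt p x (\<lambda>j. p - j) * det P * det U" by simp
  moreover have "(det P)\<^sup>2 = 1"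
    using det_mult[of P p P] carr by (simp add: PP power2_eq_square)
  moreover have "(det U)\<^sup>2 = 1"
  proof -
    have "det U = prod_list (diag_mat U)"
      by (rule det_upper_triangular[of _ p]) (auto simp: U_def)
    also have "\<dots> = (\<Prod>i<p. (-1) ^ i)"
      by (simp add: prod_list_diag_prod U_def esym_0 atLeast0LessThan)
    finally show ?thesis by (simp add: prod_power_distrib power_mult[symmetric] mult.commute power_even_eq)
  qed
  ultimately show ?thesis by (simp add: power_mult_distrib)
qed

lemma det_jacobian_nonzero: "inj_on x {1..p} \<Longrightarrow> det (jacobian p x) \<noteq> 0"
  using det_jacobian_squared[of p x] alt_vandermonde_nonzero[of x p] by auto

lemma eval_grad_identity:
  assumes "p \<ge> 1" "i < p"
  shows "(\<Sum>j<p. jacobian p x $$ (i, j) * eval_at x (QW_grad m p (j + 1))) = x (i + 1) ^ (m + p) + (- 1) ^ p"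
proof -
  have "x (i + 1) ^ (m + p) + (- 1) ^ p = eval_at x (Var (i + 1) ^ (m + p) + (- 1) ^ p)"
    by (simp add: eval_at.hom_add eval_at.hom_power eval_at.hom_uminus)
  also have "\<dots> = (\<Sum>j\<in>{1..p}. eval_at x (QW_grad m p j) * eval_at x (pdiff (i + 1) (elem_sym p j)))"
    using assms by (subst grad_identity) (auto simp: eval_at.hom_sum eval_at.hom_mult)
  also have "\<dots> = (\<Sum>j<p. jacobian p x $$ (i, j) * eval_at x (QW_grad m p (j + 1)))"
    by (rule sum.reindex_bij_witness[of _ Suc "\<lambda>j. j - 1"]) (use assms in \<open>auto simp: jacobian_def\<close>)
  finally show ?thesis by simp
qed

lemma QW_grad_eq_0_at_roots:
  assumes p: "p \<ge> 1" and inj: "inj_on x {1..p}"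
    and root: "\<And>i. i \<in> {1..p} \<Longrightarrow> x i ^ (m + p) = (- 1) ^ (p + 1)" and j: "j \<in> {1..p}"
  shows "eval_at x (QW_grad m p j) = 0"
proof -
  define q where "q = vec p (\<lambda>j. eval_at x (QW_grad m p (j + 1)))"
  have "jacobian p x *\<^sub>v q = 0\<^sub>v p"
  proof (rule eq_vecI)
    fix i assume "i < dim_vec (0\<^sub>v p :: complex vec)"
    then have i: "i < p" by simp
    have "(jacobian p x *\<^sub>v q) $ i = (\<Sum>j<p. jacobian p x $$ (i, j) * eval_at x (QW_grad m p (j + 1)))"
      using i by (simp add: jacobian_def q_def scalar_prod_def atLeast0LessThan)
    also have "\<dots> = 0" using i root[of "Suc i"] by (simp only: eval_grad_identity[OF p i]) simp
    finally show "(jacobian p x *\<^sub>v q) $ i = 0\<^sub>v p $ i" using i by simp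
  qed (simp add: jacobian_def)
  moreover have "jacobian p x \<in> carrier_mat p p" "q \<in> carrier_vec p"
    by (auto simp: jacobian_def q_def)
  ultimately have "q = 0\<^sub>v p"
    using det_0_iff_vec_prod_zero[of "jacobian p x" p] det_jacobian_nonzero[OF inj] by blast
  then have "q $ (j - 1) = 0" using j by auto
  then show ?thesis using j by (auto simp: q_def)
qed

lemma elem_point_in_crit_points:
  assumes "p \<ge> 1" "inj_on x {1..p}" "\<And>i. i \<in> {1..p} \<Longrightarrow> x i ^ (m + p) = (- 1) ^ (p + 1)"
  shows "elem_point p x \<in> crit_points m p"
  using QW_grad_eq_0_at_roots[OF assms] eval_at_QW_grad[OF assms(1)]
  by (auto simp: crit_points_def elem_point_def)

text \<open>Where \<open>x\<^sub>i = x\<^sub>j\<close> the Jacobian is singular, and the chain rule at \<open>x\<close> alone does not exclude a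
  critical point. The difference of the gradient identities for \<open>i\<close> and \<open>j\<close> is divisible by
  \<open>x\<^sub>i - x\<^sub>j\<close> as a polynomial; the quotient, evaluated at \<open>x\<close>, says that \<open>n x\<^sub>j ^ (n - 1)\<close> is a
  combination of the vanishing partial derivatives.\<close>

lemma inj_on_if_QW_grad_0:
  assumes p: "p \<ge> 1" and n: "m \<ge> 1" and x0: "\<And>i. i \<in> {1..p} \<Longrightarrow> x i \<noteq> 0"
    and grad: "\<And>j. j \<in> {1..p} \<Longrightarrow> eval_at x (QW_grad m p j) = 0"
  shows "inj_on x {1..p}"
proof (rule inj_onI, rule ccontr)
  fix i j assume ij: "i \<in> {1..p}" "j \<in> {1..p}" "x i = x j" "i \<noteq> j"
  let ?n = "m + p"
  define G where "G = (\<Sum>k\<in>{1..p}. QW_grad m p k * (if k = 1 then 0 else - esym ({1..p} - {i, j}) Var (k - 2)))"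
  define H where "H = (\<Sum>l<?n. Var j ^ (?n - Suc l) * Var i ^ l :: cpoly)"
  have "(Var i - Var j) * H = (Var i ^ ?n + (- 1) ^ p) - (Var j ^ ?n + (- 1) ^ p)"
    by (simp add: H_def power_diff_sumr2)
  also have "\<dots> = (\<Sum>k\<in>{1..p}. QW_grad m p k * (pdiff i (elem_sym p k) - pdiff j (elem_sym p k)))"
    unfolding grad_identity[OF p ij(1)] grad_identity[OF p ij(2)]
    by (simp only: sum_subtractf right_diff_distrib)
  also have "\<dots> = (Var i - Var j) * G"
    unfolding G_def sum_distrib_left
  proof (rule sum.cong)
    fix k assume k: "k \<in> {1..p}"
    show "QW_grad m p k * (pdiff i (elem_sym p k) - pdiff j (elem_sym p k)) =
        (Var i - Var j) * (QW_grad m p k * (if k = 1 then 0 else - esym ({1..p} - {i, j}) Var (k - 2)))"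
    proof (cases "k = 1")
      case True
      then show ?thesis using pdiff_elem_sym[OF ij(1), of 0] pdiff_elem_sym[OF ij(2), of 0] by (simp add: esym_0)
    next
      case False
      then obtain k' where k': "k = Suc (Suc k')" using k by (cases k; cases "k - 1") auto
      have diff: "pdiff i (elem_sym p k) - pdiff j (elem_sym p k) = (Var j - Var i) * esym ({1..p} - {i, j}) Var k'"
        unfolding k' pdiff_elem_sym[OF ij(1)] pdiff_elem_sym[OF ij(2)]
        by (rule esym_remove_diff) (use ij in auto)
      show ?thesis unfolding diff by (simp add: k' algebra_simps)
    qed
  qed simp
  finally have eq: "(Var i - Var j) * H = (Var i - Var j) * G" .
  have "Var i - Var j \<noteq> (0 :: cpoly)"
  proof
    assume "Var i - Var j = (0 :: cpoly)"
    then have "eval_at (\<lambda>l. if l = i then 1 else 0) (Var i - Var j) = eval_at (\<lambda>l. if l = i then 1 else 0) 0"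
      by (rule arg_cong)
    then show False using ij by (simp add: eval_at.hom_minus)
  qed
  with eq have "H = G" using mult_cancel_left[of "Var i - Var j" H G] by blast
  then have "eval_at x H = eval_at x G" by simp
  moreover have "eval_at x G = 0"
    unfolding G_def using grad by (simp add: eval_at.hom_sum eval_at.hom_mult)
  moreover have "eval_at x H = of_nat ?n * x j ^ (?n - 1)"
  proof -
    have "eval_at x H = (\<Sum>l<?n. x j ^ (?n - Suc l) * x j ^ l)"
      by (simp add: H_def eval_at.hom_sum eval_at.hom_mult eval_at.hom_power ij)
    also have "\<dots> = (\<Sum>l<?n. x j ^ (?n - 1))"
      by (rule sum.cong) (auto simp: power_add[symmetric])
    finally show ?thesis by simp
  qed
  ultimately have "of_nat ?n * x j ^ (?n - 1) = 0" by (simp only:)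
  moreover have "of_nat ?n \<noteq> (0 :: complex)" using p by (simp del: of_nat_add)
  ultimately show False using x0[OF ij(2)] by (simp del: of_nat_add)
qed

lemma crit_points_roots:
  assumes p: "p \<ge> 1" and m: "m \<ge> 1" and c: "c \<in> crit_points m p"
  obtains x where "inj_on x {1..p}" "\<And>i. i \<in> {1..p} \<Longrightarrow> x i ^ (m + p) = (- 1) ^ (p + 1)" "elem_point p x = c"
proof -
  obtain x where x: "\<And>k. k \<in> {1..p} \<Longrightarrow> esym {1..p} x k = c k"
    using exists_esym_eq[of p c] by auto
  have ext: "c \<in> extensional {1..p}" using c by (auto simp: crit_points_def PiE_def)
  have ec: "elem_point p x = c"
    unfolding elem_point_def by (rule extensionalityI[OF _ ext]) (auto simp: x[simplified])
  have grad: "eval_at x (QW_grad m p j) = 0" if "j \<in> {1..p}" for j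
    using that c by (simp add: eval_at_QW_grad[OF p, symmetric] ec crit_points_def)
  have root: "x i ^ (m + p) = (- 1) ^ (p + 1)" if "i \<in> {1..p}" for i
  proof -
    have "(\<Sum>j<p. jacobian p x $$ (i - 1, j) * eval_at x (QW_grad m p (j + 1))) = 0"
      by (rule sum.neutral) (auto simp: grad)
    moreover have "i - 1 < p" "i - 1 + 1 = i" using that by auto
    ultimately have "x i ^ (m + p) + (- 1) ^ p = 0"
      using eval_grad_identity[OF p, of "i - 1" x m] by simp
    then show ?thesis by (simp add: add_eq_0_iff2)
  qed
  have "x i \<noteq> 0" if "i \<in> {1..p}" for i
    using root[OF that] p by (auto simp: power_0_left split: if_splits)
  then have "inj_on x {1..p}" by (rule inj_on_if_QW_grad_0[OF p m _ grad])
  then show ?thesis using that root ec by blast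
qed

text \<open>In matrix form \<open>hessian_identity\<close> reads \<open>D H D\<^sup>T = diag (n x\<^sub>i ^ (n - 1))\<close> at a critical point, with
  \<open>D\<close> the Jacobian.\<close>

lemma hessian_det_elem_point:
  assumes p: "p \<ge> 1" and inj: "inj_on x {1..p}"
    and root: "\<And>i. i \<in> {1..p} \<Longrightarrow> x i ^ (m + p) = (- 1) ^ (p + 1)"
  shows "hessian_det m p (elem_point p x) * (alt p x (\<lambda>j. p - j))\<^sup>2
    = (\<Prod>i\<in>{1..p}. of_nat (m + p) * x i ^ (m + p - 1))"
proof -
  define D where "D = jacobian p x"
  define H where "H = mat p p (\<lambda>(i, j). eval_at (elem_point p x) (pdiff (i + 1) (pdiff (j + 1) (QW m p))))"
  define N where "N = mat p p (\<lambda>(i, l). if i = l then of_nat (m + p) * x (i + 1) ^ (m + p - 1) else 0)"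
  have carr: "D \<in> carrier_mat p p" "H \<in> carrier_mat p p" "N \<in> carrier_mat p p"
    by (simp_all add: D_def H_def N_def jacobian_def)
  have ev: "eval_at x (substitute (elem_sym p) (pdiff k (pdiff j (QW m p))))
      = eval_at (elem_point p x) (pdiff k (pdiff j (QW m p)))" for k j
    by (rule eval_at_elem_point[symmetric]) (use vars_pdiff vars_QW[OF p] in blast)
  have "D * H * transpose_mat D = N"
  proof (rule eq_matI)
    fix l i assume "l < dim_row N" "i < dim_col N"
    then have il: "i < p" "l < p" by (auto simp: N_def)
    have "N $$ (l, i) = eval_at x (if i + 1 = l + 1 then of_nat (m + p) * Var (i + 1) ^ (m + p - 1) else 0)"
      using il by (simp add: N_def eval_at.hom_mult eval_at.hom_power of_nat_eq_Const del: of_nat_add)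
    also have "\<dots> = (\<Sum>j\<in>{1..p}. (\<Sum>k\<in>{1..p}. eval_at (elem_point p x) (pdiff k (pdiff j (QW m p)))
          * eval_at x (pdiff (l + 1) (elem_sym p k))) * eval_at x (pdiff (i + 1) (elem_sym p j))
          + eval_at x (QW_grad m p j) * eval_at x (pdiff (l + 1) (pdiff (i + 1) (elem_sym p j))))"
      using il by (subst hessian_identity[OF p])
        (auto simp only: eval_at.hom_sum eval_at.hom_mult eval_at.hom_add ev atLeastAtMost_iff)
    also have "\<dots> = (\<Sum>j\<in>{1..p}. (\<Sum>k\<in>{1..p}. eval_at (elem_point p x) (pdiff k (pdiff j (QW m p)))
          * eval_at x (pdiff (l + 1) (elem_sym p k))) * eval_at x (pdiff (i + 1) (elem_sym p j)))"
      by (rule sum.cong) (simp_all only: QW_grad_eq_0_at_roots[OF p inj root] mult_zero_left add_0_right)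
    also have "\<dots> = (\<Sum>j<p. (\<Sum>k<p. H $$ (k, j) * D $$ (l, k)) * D $$ (i, j))"
      unfolding sum_atLeast1_shift
      by (intro sum.cong refl arg_cong2[of _ _ _ _ "(*)"])
        (use il in \<open>auto simp: D_def H_def jacobian_def\<close>)
    also have "\<dots> = (\<Sum>j<p. (\<Sum>k<p. D $$ (l, k) * H $$ (k, j)) * D $$ (i, j))"
      by (simp only: mult.commute)
    also have "\<dots> = (D * H * transpose_mat D) $$ (l, i)"
      using il carr by (subst index_mult_mat) (auto simp: scalar_prod_def atLeast0LessThan)
    finally show "(D * H * transpose_mat D) $$ (l, i) = N $$ (l, i)" by simp
  qed (use carr in auto)
  moreover have "det (D * H * transpose_mat D) = det (D * H) * det (transpose_mat D)"
    by (rule det_mult[of _ p]) (use carr in auto)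
  moreover have "det (D * H) = det D * det H"
    by (rule det_mult[of _ p]) (use carr in auto)
  moreover have "det (transpose_mat D) = det D" using carr by (intro det_transpose)
  ultimately have detN: "det N = det D * det H * det D" by simp
  have "det N = (\<Prod>i\<in>{1..p}. of_nat (m + p) * x i ^ (m + p - 1))"
  proof -
    have "det N = prod_list (diag_mat N)"
      by (rule det_upper_triangular[of _ p]) (auto simp: N_def)
    also have "\<dots> = (\<Prod>i<p. of_nat (m + p) * x (i + 1) ^ (m + p - 1))"
      by (simp add: prod_list_diag_prod N_def atLeast0LessThan)
    also have "\<dots> = (\<Prod>i\<in>{1..p}. of_nat (m + p) * x i ^ (m + p - 1))"
      by (rule prod.reindex_bij_witness[of _ "\<lambda>j. j - 1" Suc]) auto
    finally show ?thesis .
  qed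
  moreover have "det H = hessian_det m p (elem_point p x)" by (simp add: H_def hessian_det_def)
  ultimately show ?thesis using detN
    unfolding det_jacobian_squared[symmetric] D_def[symmetric] by (simp add: power2_eq_square mult_ac)
qed

section \<open>Sums over tuples of roots\<close>

text \<open>The set of roots is invariant under multiplication by \<open>w = exp (2 \<pi> i / n)\<close>, which multiplies
  the sum by \<open>w ^ e \<noteq> 1\<close>.\<close>

lemma sum_powers_of_roots_eq_0:
  assumes "0 < e" "e < n"
  shows "(\<Sum>z | z ^ n = \<epsilon>. z ^ e) = (0 :: complex)"
proof -
  define w where "w = cis (2 * pi / real n)"
  have n: "n > 0" using assms by simp
  have wn: "w ^ n = 1" using n by (simp add: w_def DeMoivre cis_2pi)
  have "inj_on (\<lambda>k. cis (2 * pi * real k / real n)) {..<n}"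
    using bij_betw_roots_unity[OF n] by (rule bij_betw_imp_inj_on)
  then have "cis (2 * pi * real e / real n) \<noteq> cis (2 * pi * real 0 / real n)"
    using assms by (auto dest!: inj_onD[of _ _ e 0])
  then have we: "w ^ e \<noteq> 1" by (simp add: w_def DeMoivre mult_ac)
  have "w \<noteq> 0" by (simp add: w_def)
  then have "(\<Sum>z | z ^ n = \<epsilon>. z ^ e) = (\<Sum>z | z ^ n = \<epsilon>. (w * z) ^ e)"
    by (intro sum.reindex_bij_witness[of _ "\<lambda>z. w * z" "\<lambda>z. z / w"]) (auto simp: power_mult_distrib power_divide wn)
  also have "\<dots> = w ^ e * (\<Sum>z | z ^ n = \<epsilon>. z ^ e)"
    by (simp add: power_mult_distrib sum_distrib_left)
  finally show ?thesis using we by simp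
qed

text \<open>Repeated roots are admitted so that sums factor over the coordinates; alternants vanish on the
  tuples with a repetition.\<close>

definition root_tuples :: "nat \<Rightarrow> nat \<Rightarrow> (nat \<Rightarrow> complex) set" where
  "root_tuples m p = ({1..p} \<rightarrow>\<^sub>E {z. z ^ (m + p) = (- 1) ^ (p + 1)})"

lemma finite_root_tuples: "p \<ge> 1 \<Longrightarrow> finite (root_tuples m p)"
  unfolding root_tuples_def by (intro finite_PiE finite_nth_roots) auto

lemma root_tuplesD: "x \<in> root_tuples m p \<Longrightarrow> i \<in> {1..p} \<Longrightarrow> x i ^ (m + p) = (- 1) ^ (p + 1)"
  by (auto simp: root_tuples_def)

text \<open>The power of \<open>e\<^sub>1\<close> expands into monomials of the same total degree in which every variable
  still occurs. As the degree is below \<open>p n\<close>, some exponent lies strictly between \<open>0\<close> and \<open>n\<close>, and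
  the sum over that coordinate is zero.\<close>

lemma sum_root_tuples_monomial_eq_0:
  assumes p: "p \<ge> 1" and e: "\<And>i. i \<in> {1..p} \<Longrightarrow> e i \<ge> 1" and deg: "r + (\<Sum>i\<in>{1..p}. e i) < p * (m + p)"
  shows "(\<Sum>x\<in>root_tuples m p. (\<Sum>i\<in>{1..p}. x i) ^ r * (\<Prod>i\<in>{1..p}. x i ^ e i)) = 0"
  using e deg
proof (induction r arbitrary: e)
  case 0
  have "\<exists>i\<in>{1..p}. e i < m + p"
  proof (rule ccontr)
    assume "\<not> ?thesis"
    then have "(\<Sum>i\<in>{1..p}. m + p) \<le> (\<Sum>i\<in>{1..p}. e i)" by (intro sum_mono) (auto simp: not_less)
    then show False using 0 by simp
  qed
  then obtain i where i: "i \<in> {1..p}" "e i < m + p" by blast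
  have "(\<Sum>x\<in>root_tuples m p. \<Prod>i\<in>{1..p}. x i ^ e i)
      = (\<Prod>i\<in>{1..p}. \<Sum>z | z ^ (m + p) = (- 1) ^ (p + 1). z ^ e i)"
    unfolding root_tuples_def
    by (rule prod_sum_PiE[symmetric]) (use p in \<open>auto intro: finite_nth_roots\<close>)
  also have "\<dots> = 0"
    by (rule prod_zero) (use i 0(1)[OF i(1)] in \<open>auto intro!: bexI[of _ i] sum_powers_of_roots_eq_0\<close>)
  finally show ?case by simp
next
  case (Suc r)
  have step: "(\<Sum>x\<in>root_tuples m p. (\<Sum>i\<in>{1..p}. x i) ^ r * (\<Prod>i\<in>{1..p}. x i ^ (e(k := e k + 1)) i)) = 0"
    if k: "k \<in> {1..p}" for k
  proof (rule Suc.IH)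
    have "(\<Sum>i\<in>{1..p}. (e(k := e k + 1)) i) = (\<Sum>i\<in>{1..p}. e i + (if i = k then 1 else 0))"
      by (rule sum.cong) auto
    also have "\<dots> = (\<Sum>i\<in>{1..p}. e i) + 1" using k by (simp add: sum.distrib)
    finally show "r + (\<Sum>i\<in>{1..p}. (e(k := e k + 1)) i) < p * (m + p)" using Suc.prems by simp
  qed (use Suc.prems in auto)
  have upd: "(\<Prod>i\<in>{1..p}. x i ^ (e(k := e k + 1)) i) = x k * (\<Prod>i\<in>{1..p}. x i ^ e i)"
    if k: "k \<in> {1..p}" for k and x :: "nat \<Rightarrow> complex"
  proof -
    have "(\<Prod>i\<in>{1..p}. x i ^ (e(k := e k + 1)) i) = (\<Prod>i\<in>{1..p}. (if i = k then x k else 1) * x i ^ e i)"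
      by (rule prod.cong) auto
    then show ?thesis using k by (simp add: prod.distrib)
  qed
  have "(\<Sum>x\<in>root_tuples m p. (\<Sum>i\<in>{1..p}. x i) ^ Suc r * (\<Prod>i\<in>{1..p}. x i ^ e i))
      = (\<Sum>x\<in>root_tuples m p. \<Sum>k\<in>{1..p}. (\<Sum>i\<in>{1..p}. x i) ^ r * (\<Prod>i\<in>{1..p}. x i ^ (e(k := e k + 1)) i))"
  proof (rule sum.cong)
    fix x :: "nat \<Rightarrow> complex"
    have "(\<Sum>k\<in>{1..p}. (\<Sum>i\<in>{1..p}. x i) ^ r * (\<Prod>i\<in>{1..p}. x i ^ (e(k := e k + 1)) i))
        = (\<Sum>k\<in>{1..p}. (\<Sum>i\<in>{1..p}. x i) ^ r * (x k * (\<Prod>i\<in>{1..p}. x i ^ e i)))"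
      by (intro sum.cong refl arg_cong2[of _ _ _ _ "(*)"] upd)
    also have "\<dots> = (\<Sum>i\<in>{1..p}. x i) ^ Suc r * (\<Prod>i\<in>{1..p}. x i ^ e i)"
      by (simp only: sum_distrib_left[symmetric] sum_distrib_right[symmetric] power_Suc2 mult.assoc)
    finally show "(\<Sum>i\<in>{1..p}. x i) ^ Suc r * (\<Prod>i\<in>{1..p}. x i ^ e i)
      = (\<Sum>k\<in>{1..p}. (\<Sum>i\<in>{1..p}. x i) ^ r * (\<Prod>i\<in>{1..p}. x i ^ (e(k := e k + 1)) i))" by simp
  qed simp
  also have "\<dots> = (\<Sum>k\<in>{1..p}. 0)"
    by (subst sum.swap, rule sum.cong) (simp_all only: step)
  finally show ?case by simp
qed

lemma alt_leibniz:
  "alt p x \<mu> = (\<Sum>\<pi> | \<pi> permutes {..<p}. signof \<pi> * (\<Prod>i<p. x (i + 1) ^ \<mu> (\<pi> i + 1)))"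
proof -
  have "alt p x \<mu> = (\<Sum>\<pi> | \<pi> permutes {0..<p}. signof \<pi> *
      (\<Prod>i = 0..<p. mat p p (\<lambda>(i, j). x (i + 1) ^ \<mu> (j + 1)) $$ (i, \<pi> i)))"
    unfolding alt_def by (rule det_def') simp
  also have "\<dots> = (\<Sum>\<pi> | \<pi> permutes {0..<p}. signof \<pi> * (\<Prod>i = 0..<p. x (i + 1) ^ \<mu> (\<pi> i + 1)))"
    by (intro sum.cong refl arg_cong2[of _ _ _ _ "(*)"] prod.cong) (auto dest: permutes_in_image)
  finally show ?thesis by (simp only: atLeast0LessThan)
qed

lemma alt_eq_0_if_not_inj:
  assumes "\<not> inj_on x {1..p}"
  shows "alt p x \<mu> = 0"
proof -
  obtain i j where ij: "i \<in> {1..p}" "j \<in> {1..p}" "x i = x j" "i \<noteq> j"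
    using assms by (auto simp: inj_on_def)
  show ?thesis unfolding alt_def
    by (rule det_identical_rows[of _ p "i - 1" "j - 1"]) (use ij in \<open>auto intro!: eq_vecI\<close>)
qed

lemma alt_eq_0_if_eq_exponents:
  assumes "i \<in> {1..p}" "j \<in> {1..p}" "i \<noteq> j" "\<mu> i = \<mu> j"
  shows "alt p x \<mu> = 0"
  unfolding alt_def
  by (rule det_identical_columns[of _ p "i - 1" "j - 1"]) (use assms in \<open>auto intro!: eq_vecI\<close>)

lemma alt_cong: "(\<And>j. j \<in> {1..p} \<Longrightarrow> \<mu> j = \<nu> j) \<Longrightarrow> alt p x \<mu> = alt p x \<nu>"
  unfolding alt_def by (intro arg_cong[of _ _ det] eq_matI) auto

text \<open>Pieri's rule for \<open>e\<^sub>1\<close>, before discarding the terms with a repeated exponent. In each term of the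
  Leibniz expansion, raising the exponent in column \<open>k\<close> multiplies by the variable of the row
  matched with \<open>k\<close>, and all rows are matched once.\<close>

lemma sum_times_alt: "(\<Sum>i\<in>{1..p}. x i) * alt p x \<mu> = (\<Sum>k\<in>{1..p}. alt p x (\<mu>(k := \<mu> k + 1)))"
proof -
  let ?M = "\<lambda>\<mu> \<pi>. \<Prod>i<p. x (i + 1) ^ \<mu> (\<pi> i + 1)"
  have shifted: "(\<Sum>k<p. ?M (\<mu>(k + 1 := \<mu> (k + 1) + 1)) \<pi>) = (\<Sum>i<p. x (i + 1)) * ?M \<mu> \<pi>"
    if \<pi>: "\<pi> permutes {..<p}" for \<pi>
  proof -
    have "(\<Sum>k<p. ?M (\<mu>(k + 1 := \<mu> (k + 1) + 1)) \<pi>) = (\<Sum>l<p. ?M (\<mu>(\<pi> l + 1 := \<mu> (\<pi> l + 1) + 1)) \<pi>)"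
      by (subst sum.permute[OF \<pi>]) (simp only: o_def)
    also have "\<dots> = (\<Sum>l<p. \<Prod>i<p. (if i = l then x (l + 1) else 1) * x (i + 1) ^ \<mu> (\<pi> i + 1))"
      using permutes_inj[OF \<pi>] by (intro sum.cong prod.cong) (auto simp: inj_def)
    also have "\<dots> = (\<Sum>l<p. x (l + 1) * ?M \<mu> \<pi>)"
      by (rule sum.cong) (auto simp: prod.distrib)
    finally show ?thesis by (simp only: sum_distrib_right)
  qed
  have "(\<Sum>k\<in>{1..p}. alt p x (\<mu>(k := \<mu> k + 1)))
      = (\<Sum>\<pi> | \<pi> permutes {..<p}. \<Sum>k<p. signof \<pi> * ?M (\<mu>(k + 1 := \<mu> (k + 1) + 1)) \<pi>)"
    unfolding alt_leibniz sum_atLeast1_shift by (rule sum.swap)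
  also have "\<dots> = (\<Sum>\<pi> | \<pi> permutes {..<p}. (\<Sum>i<p. x (i + 1)) * (signof \<pi> * ?M \<mu> \<pi>))"
    by (rule sum.cong[OF refl])
      (simp only: sum_distrib_left[symmetric] shifted mem_Collect_eq mult.left_commute)
  also have "\<dots> = (\<Sum>i\<in>{1..p}. x i) * alt p x \<mu>"
    unfolding alt_leibniz sum_atLeast1_shift sum_distrib_left ..
  finally show ?thesis ..
qed

text \<open>Cyclic rotation of the columns. As the moved column is constantly \<open>1\<close>, both expansions along it
  have the same minors, and the sign can be read off.\<close>

lemma alt_rotate:
  assumes p: "p \<ge> 1" and \<mu>: "\<mu> 1 = 0" and \<nu>: "\<nu> p = 0" "\<And>j. j \<in> {1..<p} \<Longrightarrow> \<nu> j = \<mu> (j + 1)"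
  shows "alt p x \<mu> = (- 1) ^ (p + 1) * alt p x \<nu>"
proof -
  obtain p' where p': "p = Suc p'" using p by (cases p) auto
  let ?A = "\<lambda>\<mu>. mat p p (\<lambda>(i, j). x (i + 1) ^ \<mu> (j + 1))"
  have del: "mat_delete (?A \<mu>) i 0 = mat_delete (?A \<nu>) i p'" if "i < p" for i
    by (rule eq_matI) (use that in \<open>auto simp: mat_delete_def p' \<nu>(2)\<close>)
  have "det (?A \<mu>) = (\<Sum>i<p. ?A \<mu> $$ (i, 0) * cofactor (?A \<mu>) i 0)"
    by (rule laplace_expansion_column) (use p in auto)
  also have "\<dots> = (\<Sum>i<p. (- 1) ^ p' * (?A \<nu> $$ (i, p') * cofactor (?A \<nu>) i p'))"
  proof (rule sum.cong)
    fix i assume "i \<in> {..<p}"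
    then have i: "i < p" by simp
    have "(- 1) ^ p' * (- 1) ^ (i + p') = ((- 1) ^ i :: complex)"
      by (cases "even p'") (simp_all add: power_add)
    moreover have "?A \<mu> $$ (i, 0) = 1" "?A \<nu> $$ (i, p') = 1" using i \<mu> \<nu>(1) p' by auto
    ultimately show "?A \<mu> $$ (i, 0) * cofactor (?A \<mu>) i 0
        = (- 1) ^ p' * (?A \<nu> $$ (i, p') * cofactor (?A \<nu>) i p')"
      unfolding cofactor_def del[OF i] by (simp only: mult_1_left mult.assoc[symmetric] add_0_right)
  qed simp
  also have "\<dots> = (- 1) ^ p' * det (?A \<nu>)"
    unfolding sum_distrib_left[symmetric]
    by (rule arg_cong2[of _ _ _ _ "(*)"] refl laplace_expansion_column[symmetric])+ (use p' in auto)
  finally show ?thesis by (simp add: alt_def p')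
qed

lemma alt_scale_column:
  assumes "p \<ge> 1" and "\<And>i. i \<in> {1..p} \<Longrightarrow> x i ^ n = \<epsilon>"
  shows "alt p x (\<mu>(1 := n)) = \<epsilon> * alt p x (\<mu>(1 := 0))"
proof -
  let ?A = "\<lambda>\<mu>. mat p p (\<lambda>(i, j). x (i + 1) ^ \<mu> (j + 1))"
  let ?a = "?A (\<mu>(1 := n))" and ?b = "?A (\<mu>(1 := 0))"
  have del: "mat_delete ?a i 0 = mat_delete ?b i 0" for i
    by (rule eq_matI) (auto simp: mat_delete_def)
  have "det ?a = (\<Sum>i<p. ?a $$ (i, 0) * cofactor ?a i 0)"
    by (rule laplace_expansion_column) (use assms in auto)
  also have "\<dots> = (\<Sum>i<p. \<epsilon> * (?b $$ (i, 0) * cofactor ?b i 0))"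
  proof (rule sum.cong)
    fix i assume "i \<in> {..<p}"
    then have "?a $$ (i, 0) = \<epsilon>" "?b $$ (i, 0) = 1" using assms by auto
    then show "?a $$ (i, 0) * cofactor ?a i 0 = \<epsilon> * (?b $$ (i, 0) * cofactor ?b i 0)"
      unfolding cofactor_def del by (simp only: mult_1_left)
  qed simp
  also have "\<dots> = \<epsilon> * (\<Sum>i<p. ?b $$ (i, 0) * cofactor ?b i 0)" by (simp only: sum_distrib_left)
  also have "(\<Sum>i<p. ?b $$ (i, 0) * cofactor ?b i 0) = det ?b"
    by (rule laplace_expansion_column[symmetric]) (use assms in auto)
  finally show ?thesis unfolding alt_def .
qed

text \<open>The quantum correction to Pieri's rule. The sign from \<open>x\<^sub>i ^ n = (-1) ^ (p + 1)\<close> and the sign of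
  moving the first of \<open>p\<close> columns to the end cancel, which is the reason for the sign in front of
  \<open>c\<^sub>1\<close> in the potential.\<close>

lemma alt_quantum_shift:
  assumes p: "p \<ge> 1" and x: "x \<in> root_tuples m p" and \<mu>: "\<mu> 1 = m + p"
    and \<nu>: "\<nu> p = 0" "\<And>j. j \<in> {1..<p} \<Longrightarrow> \<nu> j = \<mu> (j + 1)"
  shows "alt p x \<mu> = alt p x \<nu>"
proof -
  have "alt p x \<mu> = alt p x (\<mu>(1 := m + p))" using \<mu> by (metis fun_upd_triv)
  also have "\<dots> = (- 1) ^ (p + 1) * alt p x (\<mu>(1 := 0))"
    by (rule alt_scale_column[OF p]) (use root_tuplesD[OF x] in auto)
  also have "alt p x (\<mu>(1 := 0)) = (- 1) ^ (p + 1) * alt p x \<nu>"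
    by (rule alt_rotate[OF p]) (use \<nu> in auto)
  also have "(- 1) ^ (p + 1) * ((- 1) ^ (p + 1) * alt p x \<nu>) = alt p x \<nu>"
    by (cases "even p") simp_all
  finally show ?thesis .
qed

text \<open>Up to a constant, the sum over the critical points of \<open>c\<^sub>1 ^ r S / J\<close>, where \<open>S\<close> is the Schur
  polynomial with alternant exponents \<open>\<mu>\<close>; see \<open>residue_sum_eq_alt_sum\<close>.\<close>

definition alt_sum :: "nat \<Rightarrow> nat \<Rightarrow> nat \<Rightarrow> (nat \<Rightarrow> nat) \<Rightarrow> complex" where
  "alt_sum m p r \<mu> = (\<Sum>x\<in>root_tuples m p.
     (\<Sum>i\<in>{1..p}. x i) ^ r * alt p x \<mu> * alt p x (\<lambda>j. p - j) * (\<Prod>i\<in>{1..p}. x i))"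

lemma alt_sum_Suc: "alt_sum m p (Suc r) \<mu> = (\<Sum>k\<in>{1..p}. alt_sum m p r (\<mu>(k := \<mu> k + 1)))"
proof -
  have "alt_sum m p (Suc r) \<mu> = (\<Sum>x\<in>root_tuples m p. (\<Sum>i\<in>{1..p}. x i) ^ r
      * ((\<Sum>i\<in>{1..p}. x i) * alt p x \<mu>) * alt p x (\<lambda>j. p - j) * (\<Prod>i\<in>{1..p}. x i))"
    unfolding alt_sum_def by (simp only: power_Suc2 mult.assoc)
  also have "\<dots> = (\<Sum>x\<in>root_tuples m p. \<Sum>k\<in>{1..p}. (\<Sum>i\<in>{1..p}. x i) ^ r
      * alt p x (\<mu>(k := \<mu> k + 1)) * alt p x (\<lambda>j. p - j) * (\<Prod>i\<in>{1..p}. x i))"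
    unfolding sum_times_alt by (simp only: sum_distrib_left sum_distrib_right)
  also have "\<dots> = (\<Sum>k\<in>{1..p}. alt_sum m p r (\<mu>(k := \<mu> k + 1)))"
    unfolding alt_sum_def by (rule sum.swap)
  finally show ?thesis .
qed

lemma alt_sum_eq_0_if_eq_exponents:
  assumes "i \<in> {1..p}" "j \<in> {1..p}" "i \<noteq> j" "\<mu> i = \<mu> j"
  shows "alt_sum m p r \<mu> = 0"
  unfolding alt_sum_def by (simp only: alt_eq_0_if_eq_exponents[OF assms] mult_zero_left mult_zero_right sum.neutral_const)

lemma alt_sum_cong: "(\<And>j. j \<in> {1..p} \<Longrightarrow> \<mu> j = \<nu> j) \<Longrightarrow> alt_sum m p r \<mu> = alt_sum m p r \<nu>"
  unfolding alt_sum_def using alt_cong[of p \<mu> \<nu>] by simp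

lemma alt_sum_quantum_shift:
  assumes "p \<ge> 1" and "\<mu> 1 = m + p" and "\<nu> p = 0" "\<And>j. j \<in> {1..<p} \<Longrightarrow> \<nu> j = \<mu> (j + 1)"
  shows "alt_sum m p r \<mu> = alt_sum m p r \<nu>"
  unfolding alt_sum_def by (rule sum.cong) (use alt_quantum_shift[of p _ m \<mu> \<nu>] assms in simp_all)

text \<open>The elementary form of the vanishing of global residues below the degree of the Jacobian: the
  summand consists of monomials containing all variables, of total degree below \<open>p n\<close>.\<close>

lemma alt_sum_eq_0_if_low_degree:
  assumes p: "p \<ge> 1" and deg: "r + (\<Sum>j\<in>{1..p}. \<mu> j) + (\<Sum>j\<in>{1..p}. p - j) + p < p * (m + p)"
  shows "alt_sum m p r \<mu> = 0"
proof -
  let ?e = "\<lambda>\<pi> \<sigma> i. \<mu> (\<pi> (i - 1) + 1) + (p - (\<sigma> (i - 1) + 1)) + 1"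
  let ?s = "\<lambda>x. (\<Sum>i\<in>{1..p}. x i) ^ r"
  let ?Perm = "{\<pi>. \<pi> permutes {..<p}}"
  have mono: "(\<Sum>x\<in>root_tuples m p. ?s x * (\<Prod>i\<in>{1..p}. x i ^ ?e \<pi> \<sigma> i)) = 0"
    if "\<pi> permutes {..<p}" "\<sigma> permutes {..<p}" for \<pi> \<sigma>
  proof (rule sum_root_tuples_monomial_eq_0[OF p])
    have "(\<Sum>i\<in>{1..p}. ?e \<pi> \<sigma> i) = (\<Sum>i<p. \<mu> (\<pi> i + 1)) + (\<Sum>i<p. p - (\<sigma> i + 1)) + p"
      unfolding sum_atLeast1_shift by (simp add: sum.distrib sum_Suc)
    also have "(\<Sum>i<p. \<mu> (\<pi> i + 1)) = (\<Sum>j\<in>{1..p}. \<mu> j)"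
      using sum.permute[OF that(1), of "\<lambda>i. \<mu> (i + 1)"] unfolding sum_atLeast1_shift o_def by simp
    also have "(\<Sum>i<p. p - (\<sigma> i + 1)) = (\<Sum>j\<in>{1..p}. p - j)"
      using sum.permute[OF that(2), of "\<lambda>i. p - (i + 1)"] unfolding sum_atLeast1_shift o_def by simp
    finally show "r + (\<Sum>i\<in>{1..p}. ?e \<pi> \<sigma> i) < p * (m + p)" using deg by simp
  qed simp
  have prods: "(\<Prod>i\<in>{1..p}. x i ^ ?e \<pi> \<sigma> i) = (\<Prod>i<p. x (i + 1) ^ \<mu> (\<pi> i + 1))
      * (\<Prod>i<p. x (i + 1) ^ (p - (\<sigma> i + 1))) * (\<Prod>i\<in>{1..p}. x i)" for x :: "nat \<Rightarrow> complex" and \<pi> \<sigma>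
  proof -
    have shift: "(\<Prod>i\<in>{1..p}. f i) = (\<Prod>i<p. f (i + 1))" for f :: "nat \<Rightarrow> complex"
      by (rule prod.reindex_bij_witness[of _ Suc "\<lambda>j. j - 1"]) auto
    show ?thesis unfolding shift prod.distrib[symmetric]
      by (rule prod.cong) (auto simp: power_add)
  qed
  have "alt_sum m p r \<mu> = (\<Sum>x\<in>root_tuples m p. \<Sum>\<pi>\<in>?Perm. \<Sum>\<sigma>\<in>?Perm.
      signof \<pi> * signof \<sigma> * (?s x * (\<Prod>i\<in>{1..p}. x i ^ ?e \<pi> \<sigma> i)))"
    unfolding alt_sum_def
  proof (rule sum.cong)
    fix x :: "nat \<Rightarrow> complex"
    have "?s x * alt p x \<mu> * alt p x (\<lambda>j. p - j) * (\<Prod>i\<in>{1..p}. x i)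
      = ?s x * (alt p x \<mu> * alt p x (\<lambda>j. p - j)) * (\<Prod>i\<in>{1..p}. x i)"
      by (simp only: mult.assoc)
    also have "\<dots> = (\<Sum>\<pi>\<in>?Perm. \<Sum>\<sigma>\<in>?Perm. ?s x *
        ((signof \<pi> * (\<Prod>i<p. x (i + 1) ^ \<mu> (\<pi> i + 1))) * (signof \<sigma> * (\<Prod>i<p. x (i + 1) ^ (p - (\<sigma> i + 1)))))
        * (\<Prod>i\<in>{1..p}. x i))"
      unfolding alt_leibniz sum_product by (simp only: sum_distrib_left sum_distrib_right)
    also have "\<dots> = (\<Sum>\<pi>\<in>?Perm. \<Sum>\<sigma>\<in>?Perm. signof \<pi> * signof \<sigma> * (?s x * (\<Prod>i\<in>{1..p}. x i ^ ?e \<pi> \<sigma> i)))"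
      unfolding prods by (intro sum.cong refl) (simp only: mult_ac)
    finally show "?s x * alt p x \<mu> * alt p x (\<lambda>j. p - j) * (\<Prod>i\<in>{1..p}. x i)
      = (\<Sum>\<pi>\<in>?Perm. \<Sum>\<sigma>\<in>?Perm. signof \<pi> * signof \<sigma> * (?s x * (\<Prod>i\<in>{1..p}. x i ^ ?e \<pi> \<sigma> i)))" .
  qed simp
  also have "\<dots> = (\<Sum>\<pi>\<in>?Perm. \<Sum>\<sigma>\<in>?Perm. signof \<pi> * signof \<sigma> *
      (\<Sum>x\<in>root_tuples m p. ?s x * (\<Prod>i\<in>{1..p}. x i ^ ?e \<pi> \<sigma> i)))"
    unfolding sum_distrib_left by (subst sum.swap, rule sum.cong[OF refl], rule sum.swap)
  also have "\<dots> = 0"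
    by (intro sum.neutral ballI) (simp only: mono mem_Collect_eq mult_zero_right)
  finally show ?thesis .
qed

section \<open>From critical points to tuples of roots\<close>

lemma prod_roots_eq_iff_elem_point_eq:
  "elem_point p x = elem_point p y \<longleftrightarrow> (\<forall>t. (\<Prod>i\<in>{1..p}. t - x i) = (\<Prod>i\<in>{1..p}. t - y i))"
proof -
  have "elem_point p x = elem_point p y \<longleftrightarrow> (\<forall>k\<in>{1..p}. esym {1..p} x k = esym {1..p} y k)"
    unfolding elem_point_def by (auto simp: fun_eq_iff restrict_def)
  also have "\<dots> \<longleftrightarrow> (\<forall>t. (\<Prod>i\<in>{1..p}. t - x i) = t ^ p + (\<Sum>k\<in>{1..p}. (-1) ^ k * esym {1..p} y k * t ^ (p - k)))"
    by (rule esym_eq_iff_prod_eq)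
  also have "(\<lambda>t. t ^ p + (\<Sum>k\<in>{1..p}. (-1) ^ k * esym {1..p} y k * t ^ (p - k))) = (\<lambda>t. \<Prod>i\<in>{1..p}. t - y i)"
    using esym_eq_iff_prod_eq[of p y "esym {1..p} y"] by auto
  finally show ?thesis by (simp add: fun_eq_iff)
qed

text \<open>Tuples with the same elementary symmetric functions have the same roots, hence differ by a
  permutation; distinctness of the coordinates makes the permutation unique.\<close>

lemma card_elem_point_fibre:
  assumes inj: "inj_on x {1..p}" and x: "x \<in> root_tuples m p"
  shows "card {y \<in> root_tuples m p. inj_on y {1..p} \<and> elem_point p y = elem_point p x} = fact p"
proof -
  let ?f = "\<lambda>\<pi>. restrict (x \<circ> \<pi>) {1..p}"
  let ?P = "{\<pi>. \<pi> permutes {1..p}}"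
  have "inj_on ?f ?P"
  proof (rule inj_onI)
    fix \<pi> \<sigma> assume ps: "\<pi> \<in> ?P" "\<sigma> \<in> ?P" "?f \<pi> = ?f \<sigma>"
    show "\<pi> = \<sigma>"
    proof
      fix i
      show "\<pi> i = \<sigma> i"
      proof (cases "i \<in> {1..p}")
        case True
        then have "x (\<pi> i) = x (\<sigma> i)" using fun_cong[OF ps(3), of i] by simp
        moreover have "\<pi> i \<in> {1..p}" "\<sigma> i \<in> {1..p}" using True ps
          permutes_in_image[of \<pi> "{1..p}" i] permutes_in_image[of \<sigma> "{1..p}" i] by simp_all
        ultimately show ?thesis using inj by (blast dest: inj_onD)
      qed (use ps in \<open>simp add: permutes_not_in\<close>)
    qed
  qed
  moreover have "?f ` ?P = {y \<in> root_tuples m p. inj_on y {1..p} \<and> elem_point p y = elem_point p x}"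
  proof (rule equalityI; rule subsetI)
    fix y assume "y \<in> ?f ` ?P"
    then obtain \<pi> where \<pi>: "\<pi> permutes {1..p}" "y = ?f \<pi>" by blast
    have mem: "\<pi> i \<in> {1..p}" if "i \<in> {1..p}" for i using permutes_in_image[OF \<pi>(1)] that by blast
    have "y \<in> root_tuples m p" using x mem by (auto simp: root_tuples_def \<pi>(2))
    moreover have "inj_on y {1..p}"
      unfolding \<pi>(2) inj_on_restrict_eq
      by (rule comp_inj_on) (simp_all add: permutes_inj_on[OF \<pi>(1)] permutes_image[OF \<pi>(1)] inj del: atLeastAtMost_iff One_nat_def)
    moreover have "(\<Prod>i\<in>{1..p}. t - y i) = (\<Prod>i\<in>{1..p}. t - x i)" for t
      using prod.permute[OF \<pi>(1), of "\<lambda>i. t - x i"] by (simp add: \<pi>(2))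
    ultimately show "y \<in> {y \<in> root_tuples m p. inj_on y {1..p} \<and> elem_point p y = elem_point p x}"
      by (simp add: prod_roots_eq_iff_elem_point_eq)
  next
    fix y assume "y \<in> {y \<in> root_tuples m p. inj_on y {1..p} \<and> elem_point p y = elem_point p x}"
    then have y: "y \<in> root_tuples m p" "inj_on y {1..p}"
      and eq: "(\<Prod>i\<in>{1..p}. t - y i) = (\<Prod>i\<in>{1..p}. t - x i)" for t
      by (auto simp: prod_roots_eq_iff_elem_point_eq)
    have "t \<in> y ` {1..p} \<longleftrightarrow> t \<in> x ` {1..p}" for t
    proof -
      have zero: "t \<in> z ` {1..p} \<longleftrightarrow> (\<Prod>i\<in>{1..p}. t - z i) = 0" for z :: "nat \<Rightarrow> complex"
        by (auto simp: prod_zero_iff)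
      show ?thesis by (simp only: zero eq)
    qed
    then have img: "y ` {1..p} = x ` {1..p}" by blast
    define \<pi> where "\<pi> i = (if i \<in> {1..p} then inv_into {1..p} x (y i) else i)" for i
    have x\<pi>: "\<pi> i \<in> {1..p} \<and> x (\<pi> i) = y i" if "i \<in> {1..p}" for i
    proof -
      have "y i \<in> x ` {1..p}" using img that by blast
      then show ?thesis unfolding \<pi>_def if_P[OF that]
        using inv_into_into[of "y i" x "{1..p}"] f_inv_into_f[of "y i" x "{1..p}"] by blast
    qed
    have "inj_on \<pi> {1..p}"
    proof (rule inj_onI)
      fix i j assume ij: "i \<in> {1..p}" "j \<in> {1..p}" "\<pi> i = \<pi> j"
      then have "y i = y j" using x\<pi>[OF ij(1)] x\<pi>[OF ij(2)] by simp
      then show "i = j" using y(2) ij by (blast dest: inj_onD)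
    qed
    moreover have "\<pi> ` {1..p} \<subseteq> {1..p}" using x\<pi> by blast
    ultimately have "bij_betw \<pi> {1..p} {1..p}"
      by (simp add: bij_betw_def endo_inj_surj)
    then have "\<pi> permutes {1..p}"
      by (rule bij_imp_permutes) (simp only: \<pi>_def if_False)
    moreover have "y = ?f \<pi>"
      by (rule ext) (use x\<pi> y(1) in \<open>auto simp: root_tuples_def restrict_def PiE_def extensional_def\<close>)
    ultimately show "y \<in> ?f ` ?P" by blast
  qed
  ultimately have "card {y \<in> root_tuples m p. inj_on y {1..p} \<and> elem_point p y = elem_point p x} = card ?P"
    using card_image[of ?f ?P] by simp
  then show ?thesis by (simp add: card_permutations)
qed

lemma crit_points_eq:
  assumes "p \<ge> 1" "m \<ge> 1"
  shows "crit_points m p = elem_point p ` {x \<in> root_tuples m p. inj_on x {1..p}}"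
proof (rule equalityI; rule subsetI)
  fix c assume c: "c \<in> crit_points m p"
  obtain x where x: "inj_on x {1..p}" "\<And>i. i \<in> {1..p} \<Longrightarrow> x i ^ (m + p) = (- 1) ^ (p + 1)" "elem_point p x = c"
    by (rule crit_points_roots[OF assms c]) (rule that)
  let ?y = "restrict x {1..p}"
  have "elem_point p ?y = elem_point p x"
    unfolding elem_point_def by (intro restrict_ext esym_cong) simp
  with x(3) have "c = elem_point p ?y" by argo
  moreover have "?y \<in> root_tuples m p"
    using x(2) by (auto simp: root_tuples_def)
  moreover have "inj_on ?y {1..p}" unfolding inj_on_restrict_eq by (rule x(1))
  ultimately show "c \<in> elem_point p ` {x \<in> root_tuples m p. inj_on x {1..p}}"
    by (intro image_eqI[of _ _ ?y] CollectI conjI)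
next
  fix c assume "c \<in> elem_point p ` {x \<in> root_tuples m p. inj_on x {1..p}}"
  then obtain x where c: "c = elem_point p x" and "x \<in> {x \<in> root_tuples m p. inj_on x {1..p}}"
    by (rule imageE)
  then have x: "x \<in> root_tuples m p" "inj_on x {1..p}" by simp_all
  show "c \<in> crit_points m p"
    unfolding c by (rule elem_point_in_crit_points[OF assms(1) x(2) root_tuplesD[OF x(1)]])
qed

lemma sum_crit_points:
  assumes "p \<ge> 1" "m \<ge> 1"
  shows "(\<Sum>x | x \<in> root_tuples m p \<and> inj_on x {1..p}. F (elem_point p x)) = fact p * (\<Sum>c\<in>crit_points m p. F c :: complex)"
proof -
  let ?I = "{x \<in> root_tuples m p. inj_on x {1..p}}"
  have fin: "finite ?I" using finite_root_tuples[OF assms(1)] by simp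
  have "(\<Sum>x\<in>?I. F (elem_point p x)) = (\<Sum>c\<in>crit_points m p. \<Sum>x | x \<in> ?I \<and> elem_point p x = c. F (elem_point p x))"
    unfolding crit_points_eq[OF assms] by (rule sum.image_gen[OF fin])
  also have "\<dots> = (\<Sum>c\<in>crit_points m p. fact p * F c)"
  proof (rule sum.cong)
    fix c assume "c \<in> crit_points m p"
    then obtain x where x: "c = elem_point p x" "x \<in> ?I" unfolding crit_points_eq[OF assms] by (rule imageE)
    have "card {y. y \<in> ?I \<and> elem_point p y = c} = fact p"
      using card_elem_point_fibre[of x p m] x by (simp add: conj_assoc)
    moreover have "(\<Sum>x | x \<in> ?I \<and> elem_point p x = c. F (elem_point p x)) = (\<Sum>x | x \<in> ?I \<and> elem_point p x = c. F c)"
      by (rule sum.cong) auto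
    ultimately show "(\<Sum>x | x \<in> ?I \<and> elem_point p x = c. F (elem_point p x)) = fact p * F c" by simp
  qed simp
  finally show ?thesis by (simp only: sum_distrib_left)
qed

text \<open>At a tuple of distinct roots \<open>S = alt\<^sub>\<mu> / \<Delta>\<close> and \<open>1 / J = \<Delta>\<^sup>2 / \<Prod>\<^sub>i n x\<^sub>i ^ (n - 1)\<close>, while \<open>x\<^sub>i ^ (n - 1)\<close> is
  \<open>(-1) ^ (p + 1) / x\<^sub>i\<close>. Tuples with a repeated root may be added because \<open>\<Delta>\<close> vanishes there.\<close>

lemma residue_sum_eq_alt_sum:
  assumes p: "p \<ge> 1" and m: "m \<ge> 1"
    and s: "in_elems p s" "s * alternant p (\<lambda>j. p - j) = alternant p \<mu>"
  shows "(\<Sum>c\<in>crit_points m p. c 1 ^ r * eval_at c (in_elem_sym p s) / hessian_det m p c)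
    = alt_sum m p r \<mu> / (fact p * (of_nat (m + p) * (- 1) ^ (p + 1)) ^ p)"
proof -
  let ?I = "{x \<in> root_tuples m p. inj_on x {1..p}}"
  let ?F = "\<lambda>c. c 1 ^ r * eval_at c (in_elem_sym p s) / hessian_det m p c"
  let ?K = "(of_nat (m + p) * (- 1) ^ (p + 1)) ^ p :: complex"
  let ?T = "\<lambda>x. (\<Sum>i\<in>{1..p}. x i) ^ r * alt p x \<mu> * alt p x (\<lambda>j. p - j) * (\<Prod>i\<in>{1..p}. x i)"
  have K: "?K \<noteq> 0" using p by (simp del: of_nat_add)
  have F: "?F (elem_point p x) * ?K = ?T x" if x: "x \<in> ?I" for x
  proof -
    from x have inj: "inj_on x {1..p}" and root: "\<And>i. i \<in> {1..p} \<Longrightarrow> x i ^ (m + p) = (- 1) ^ (p + 1)"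
      using root_tuplesD by auto
    let ?V = "alt p x (\<lambda>j. p - j)" and ?h = "hessian_det m p (elem_point p x)"
    have V: "?V \<noteq> 0" by (rule alt_vandermonde_nonzero[OF inj])
    have x1: "elem_point p x 1 = (\<Sum>i\<in>{1..p}. x i)"
    proof -
      have "esym {1..p} x 1 = (\<Sum>i\<in>{1..p}. x i)"
        unfolding esym_def
        by (rule sum.reindex_bij_witness[of _ "\<lambda>i. {i}" the_elem]) (auto simp: card_1_singleton_iff)
      then show ?thesis using p by (simp add: elem_point_def)
    qed
    have S: "eval_at (elem_point p x) (in_elem_sym p s) * ?V = alt p x \<mu>"
      using arg_cong[OF s(2), of "eval_at x"] vars_in_elem_sym[OF s(1)]
      by (simp add: eval_at_elem_point substitute_in_elem_sym[OF s(1)] eval_at.hom_mult eval_at_alternant)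
    have "?h * ?V\<^sup>2 * (\<Prod>i\<in>{1..p}. x i) = (\<Prod>i\<in>{1..p}. of_nat (m + p) * x i ^ (m + p - 1) * x i)"
      by (simp only: hessian_det_elem_point[OF p inj root] prod.distrib)
    also have "\<dots> = (\<Prod>i\<in>{1..p}. of_nat (m + p) * (- 1) ^ (p + 1))"
    proof (rule prod.cong)
      fix i assume i: "i \<in> {1..p}"
      have "x i ^ (m + p - 1) * x i = x i ^ (m + p)"
        using p by (simp add: power_Suc2[symmetric] del: power_Suc)
      then show "of_nat (m + p) * x i ^ (m + p - 1) * x i = of_nat (m + p) * (- 1) ^ (p + 1)"
        by (simp only: mult.assoc root[OF i])
    qed simp
    also have "\<dots> = ?K" by simp
    finally have h: "?h * ?V\<^sup>2 * (\<Prod>i\<in>{1..p}. x i) = ?K" .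
    then have h0: "?h \<noteq> 0" using K by auto
    show ?thesis unfolding x1 S[symmetric] h[symmetric] using h0 by (simp add: field_simps power2_eq_square)
  qed
  have "alt_sum m p r \<mu> = (\<Sum>x\<in>?I. ?T x)"
    unfolding alt_sum_def
    by (rule sum.mono_neutral_right[OF finite_root_tuples[OF p]]) (auto simp: alt_eq_0_if_not_inj)
  also have "\<dots> = (\<Sum>x\<in>?I. ?F (elem_point p x) * ?K)"
    by (rule sum.cong[OF refl]) (rule F[symmetric])
  also have "\<dots> = (\<Sum>x\<in>?I. ?F (elem_point p x)) * ?K" by (simp only: sum_distrib_right)
  also have "\<dots> = fact p * (\<Sum>c\<in>crit_points m p. ?F c) * ?K"
    by (simp only: sum_crit_points[OF p m, of ?F])
  finally have "alt_sum m p r \<mu> = (\<Sum>c\<in>crit_points m p. ?F c) * (fact p * ?K)" by (simp only: mult_ac)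
  then show ?thesis using K by (simp only: nonzero_mult_div_cancel_right fact_nonzero mult_eq_0_iff not_False_eq_True simp_thms)
qed

section \<open>Covers in the poset of indices\<close>

lemma indicesD:
  assumes "(\<alpha>, a) \<in> indices q m p"
  shows "length \<alpha> = p" "a \<le> q"
    and "\<And>i j. 1 \<le> i \<Longrightarrow> i < j \<Longrightarrow> j \<le> p \<Longrightarrow> entry \<alpha> i < entry \<alpha> j"
    and "\<And>i. 1 \<le> i \<Longrightarrow> i \<le> p \<Longrightarrow> 1 \<le> entry \<alpha> i \<and> entry \<alpha> i \<le> m + p"
proof -
  have len: "length \<alpha> = p" and srt: "sorted_wrt (<) \<alpha>" and sub: "set \<alpha> \<subseteq> {1..m + p}" and "a \<le> q"
    using assms by (auto simp: indices_def)
  then show "length \<alpha> = p" "a \<le> q" by auto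
  show "entry \<alpha> i < entry \<alpha> j" if "1 \<le> i" "i < j" "j \<le> p" for i j
    unfolding entry_def by (rule sorted_wrt_nth_less[OF srt]) (use that len in auto)
  show "1 \<le> entry \<alpha> i \<and> entry \<alpha> i \<le> m + p" if "1 \<le> i" "i \<le> p" for i
  proof -
    have "\<alpha> ! (i - 1) \<in> set \<alpha>" by (rule nth_mem) (use that len in auto)
    then have "\<alpha> ! (i - 1) \<in> {1..m + p}" using sub by (rule rev_subsetD)
    then show ?thesis by (simp add: entry_def)
  qed
qed

lemma indicesI:
  assumes len: "length \<alpha> = p" and "a \<le> q"
    and step: "\<And>i. 1 \<le> i \<Longrightarrow> i < p \<Longrightarrow> entry \<alpha> i < entry \<alpha> (i + 1)"
    and bd: "\<And>i. 1 \<le> i \<Longrightarrow> i \<le> p \<Longrightarrow> 1 \<le> entry \<alpha> i \<and> entry \<alpha> i \<le> m + p"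
  shows "(\<alpha>, a) \<in> indices q m p"
proof -
  have "sorted_wrt (<) \<alpha>"
    unfolding sorted_wrt_iff_nth_Suc_transp[OF transp_on_less]
    using step[of "Suc _"] len by (auto simp: entry_def)
  moreover have "set \<alpha> \<subseteq> {1..m + p}"
  proof
    fix v assume "v \<in> set \<alpha>"
    then obtain i where "i < p" "v = \<alpha> ! i" using len by (auto simp: in_set_conv_nth)
    then show "v \<in> {1..m + p}" using bd[of "Suc i"] by (simp add: entry_def)
  qed
  ultimately show ?thesis using assms by (simp add: indices_def)
qed

lemma entry_eqI:
  assumes "length \<alpha> = p" "length \<beta> = p" "\<And>i. 1 \<le> i \<Longrightarrow> i \<le> p \<Longrightarrow> entry \<alpha> i = entry \<beta> i"
  shows "\<alpha> = \<beta>"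
proof (rule nth_equalityI)
  fix i assume "i < length \<alpha>"
  then show "\<alpha> ! i = \<beta> ! i" using assms(3)[of "Suc i"] assms(1) by (simp add: entry_def)
qed (use assms in simp)

lemma entry_bounds:
  assumes "(\<alpha>, a) \<in> indices q m p" "1 \<le> i" "i \<le> p"
  shows "i \<le> entry \<alpha> i" "entry \<alpha> i \<le> m + i"
proof -
  note D = indicesD[OF assms(1)]
  show "i \<le> entry \<alpha> i" using assms(2,3)
  proof (induction i rule: dec_induct)
    case base
    then show ?case using D(4)[of 1] by simp
  next
    case (step i)
    then show ?case using D(3)[of i "Suc i"] by simp
  qed
  have "entry \<alpha> (p - k) \<le> m + (p - k)" if "k < p" for k
    using that
  proof (induction k)
    case 0
    then show ?case using D(4)[of p] by simp
  next
    case (Suc k)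
    then have "entry \<alpha> (p - Suc k) < entry \<alpha> (p - k)" by (intro D(3)) auto
    moreover have "entry \<alpha> (p - k) \<le> m + (p - k)" using Suc by simp
    moreover have "p - k = Suc (p - Suc k)" using Suc.prems by simp
    ultimately show ?case by linarith
  qed
  from this[of "p - i"] show "entry \<alpha> i \<le> m + i" using assms(2,3) by simp
qed

lemma index_rank_plus:
  assumes "(\<alpha>, a) \<in> indices q m p"
  shows "index_rank m p (\<alpha>, a) + (\<Sum>i=1..p. i) = a * (m + p) + (\<Sum>i=1..p. entry \<alpha> i)"
proof -
  have "(\<Sum>i=1..p. entry \<alpha> i - i) + (\<Sum>i=1..p. i) = (\<Sum>i=1..p. entry \<alpha> i)"
    unfolding sum.distrib[symmetric]
    by (rule sum.cong) (use entry_bounds(1)[OF assms] in auto)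
  then show ?thesis by (simp add: index_rank_def)
qed

text \<open>For \<open>d = a - b > 0\<close> the order bounds all but the last \<open>d\<close> entries of \<open>\<beta>\<close> by entries of \<open>\<alpha>\<close> other
  than the first; the last \<open>d\<close> are at most \<open>n\<close> each, which the \<open>d n\<close> in the rank of \<open>\<alpha>\<^sup>(\<^sup>a\<^sup>)\<close> pays for.\<close>

lemma index_rank_strict_mono:
  assumes y: "(\<beta>, b) \<in> indices q m p" and z: "(\<alpha>, a) \<in> indices q m p"
    and less: "index_less p (\<beta>, b) (\<alpha>, a)" and p: "p \<ge> 1"
  shows "index_rank m p (\<beta>, b) < index_rank m p (\<alpha>, a)"
proof -
  define d where "d = a - b"
  have ba: "b \<le> a" and le: "\<And>i. 1 \<le> i \<Longrightarrow> i \<le> p - d \<Longrightarrow> entry \<beta> i \<le> entry \<alpha> (d + i)"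
    and ne: "(\<beta>, b) \<noteq> (\<alpha>, a)"
    using less by (auto simp: index_less_def index_le_def d_def)
  have "(\<Sum>i=1..p. entry \<beta> i) < d * (m + p) + (\<Sum>i=1..p. entry \<alpha> i)"
  proof (cases "d = 0")
    case True
    have "\<exists>i\<in>{1..p}. entry \<beta> i < entry \<alpha> i"
    proof (rule ccontr)
      assume "\<not> ?thesis"
      then have "entry \<beta> i = entry \<alpha> i" if "1 \<le> i" "i \<le> p" for i
        using le[of i] that True by (force simp: not_less)
      then have "\<beta> = \<alpha>" by (rule entry_eqI[OF indicesD(1)[OF y] indicesD(1)[OF z]])
      then show False using ne True ba by (simp add: d_def)
    qed
    then have "(\<Sum>i=1..p. entry \<beta> i) < (\<Sum>i=1..p. entry \<alpha> i)"
      using le True by (intro sum_strict_mono_ex1) auto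
    then show ?thesis by simp
  next
    case False
    let ?s = "p - d"
    have "{1..p} = {1..?s} \<union> {?s + 1..p}" by auto
    then have "(\<Sum>i=1..p. entry \<beta> i) = (\<Sum>i=1..?s. entry \<beta> i) + (\<Sum>i=?s + 1..p. entry \<beta> i)"
      by (simp add: sum.union_disjoint)
    also have "(\<Sum>i=?s + 1..p. entry \<beta> i) \<le> (\<Sum>i=?s + 1..p. m + p)"
      using indicesD(4)[OF y] by (intro sum_mono) auto
    also have "\<dots> = (p - ?s) * (m + p)" by simp
    also have "\<dots> \<le> d * (m + p)" by (intro mult_right_mono) auto
    also have "(\<Sum>i=1..?s. entry \<beta> i) \<le> (\<Sum>i=1..?s. entry \<alpha> (d + i))"
      using le by (intro sum_mono) auto
    also have "\<dots> = (\<Sum>j\<in>(\<lambda>i. d + i) ` {1..?s}. entry \<alpha> j)"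
      by (subst sum.reindex) (auto simp: inj_on_def)
    also have "\<dots> \<le> (\<Sum>j=2..p. entry \<alpha> j)"
      using False by (intro sum_mono2) auto
    also have "\<dots> < (\<Sum>j=1..p. entry \<alpha> j)"
    proof -
      have "{1..p} = insert 1 {2..p}" using p by auto
      then have "(\<Sum>j=1..p. entry \<alpha> j) = entry \<alpha> 1 + (\<Sum>j=2..p. entry \<alpha> j)" by simp
      then show ?thesis using indicesD(4)[OF z, of 1] p by simp
    qed
    finally show ?thesis by simp
  qed
  moreover have "a * (m + p) = b * (m + p) + d * (m + p)"
    using ba by (simp add: d_def distrib_right[symmetric])
  ultimately show ?thesis
    using index_rank_plus[OF y] index_rank_plus[OF z] by linarith
qed

definition lower :: "nat list \<Rightarrow> nat \<Rightarrow> nat list" where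
  "lower \<alpha> k = \<alpha>[k - 1 := entry \<alpha> k - 1]"

text \<open>Lowering entry \<open>k\<close> by one leaves a strictly increasing sequence of positive numbers.\<close>

definition lowerable :: "nat list \<Rightarrow> nat \<Rightarrow> bool" where
  "lowerable \<alpha> k \<longleftrightarrow> (if k = 1 then 1 < entry \<alpha> 1 else entry \<alpha> (k - 1) + 1 < entry \<alpha> k)"

text \<open>The sequence \<open>(\<alpha>\<^sub>2, \<dots>, \<alpha>\<^sub>p, n)\<close>, which arises from \<open>\<alpha>\<close> by lowering \<open>\<alpha>\<^sub>1 = 1\<close> to \<open>0\<close> and identifying
  \<open>0\<close> with \<open>n\<close> one level below.\<close>

definition rotate_up :: "nat \<Rightarrow> nat list \<Rightarrow> nat list" where
  "rotate_up n \<alpha> = tl \<alpha> @ [n]"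

lemma entry_lower:
  assumes "length \<alpha> = p" "1 \<le> i" "i \<le> p" "1 \<le> k" "k \<le> p"
  shows "entry (lower \<alpha> k) i = (if i = k then entry \<alpha> k - 1 else entry \<alpha> i)"
  using assms by (auto simp: lower_def entry_def nth_list_update)

lemma entry_rotate_up:
  assumes "length \<alpha> = p" "1 \<le> i" "i \<le> p"
  shows "entry (rotate_up n \<alpha>) i = (if i < p then entry \<alpha> (i + 1) else n)"
  using assms by (auto simp: rotate_up_def entry_def nth_append nth_tl)

lemma length_lower: "length (lower \<alpha> k) = length \<alpha>"
  by (simp add: lower_def)

lemma length_rotate_up: "length \<alpha> \<ge> 1 \<Longrightarrow> length (rotate_up n \<alpha>) = length \<alpha>"
  by (simp add: rotate_up_def)

lemma lower_in_indices:
  assumes z: "(\<alpha>, a) \<in> indices q m p" and k: "1 \<le> k" "k \<le> p" and low: "lowerable \<alpha> k"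
  shows "(lower \<alpha> k, a) \<in> indices q m p"
proof -
  note D = indicesD[OF z]
  note E = entry_lower[OF D(1) _ _ k]
  show ?thesis
  proof (rule indicesI)
    show "length (lower \<alpha> k) = p" "a \<le> q" using D(1,2) by (simp_all add: length_lower)
    show "entry (lower \<alpha> k) i < entry (lower \<alpha> k) (i + 1)" if "1 \<le> i" "i < p" for i
      using D(3)[of i "i + 1"] that low E[of i] E[of "i + 1"] by (auto simp: lowerable_def split: if_splits)
    show "1 \<le> entry (lower \<alpha> k) i \<and> entry (lower \<alpha> k) i \<le> m + p" if "1 \<le> i" "i \<le> p" for i
      using D(4)[of i] that low E[of i] by (auto simp: lowerable_def split: if_splits)
  qed
qed

lemma rotate_up_in_indices:
  assumes z: "(\<alpha>, a) \<in> indices q m p" and p: "p \<ge> 1" and last: "entry \<alpha> p < m + p"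
  shows "(rotate_up (m + p) \<alpha>, a - 1) \<in> indices q m p"
proof -
  note D = indicesD[OF z]
  note E = entry_rotate_up[OF D(1)]
  show ?thesis
  proof (rule indicesI)
    show "length (rotate_up (m + p) \<alpha>) = p" "a - 1 \<le> q" using D(1,2) p by (simp_all add: length_rotate_up)
    show "entry (rotate_up (m + p) \<alpha>) i < entry (rotate_up (m + p) \<alpha>) (i + 1)" if "1 \<le> i" "i < p" for i
    proof (cases "i + 1 = p")
      case True
      then show ?thesis using that last by (simp add: E)
    next
      case False
      then show ?thesis using that D(3)[of "i + 1" "i + 2"] by (simp add: E)
    qed
    show "1 \<le> entry (rotate_up (m + p) \<alpha>) i \<and> entry (rotate_up (m + p) \<alpha>) i \<le> m + p" if "1 \<le> i" "i \<le> p" for i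
      using that D(4)[of "i + 1"] p by (simp add: E)
  qed
qed

lemma sum_entry_lower:
  assumes z: "(\<alpha>, a) \<in> indices q m p" and k: "1 \<le> k" "k \<le> p"
  shows "(\<Sum>i=1..p. entry (lower \<alpha> k) i) + 1 = (\<Sum>i=1..p. entry \<alpha> i)"
proof -
  note D = indicesD[OF z]
  have "(\<Sum>i=1..p. entry (lower \<alpha> k) i) + (\<Sum>i=1..p. if i = k then 1 else 0) = (\<Sum>i=1..p. entry \<alpha> i)"
    unfolding sum.distrib[symmetric]
    by (rule sum.cong) (use entry_lower[OF D(1) _ _ k] D(4)[of k] k in auto)
  then show ?thesis using k by simp
qed

lemma sum_entry_rotate_up:
  assumes z: "(\<alpha>, a) \<in> indices q m p" and p: "p \<ge> 1"
  shows "(\<Sum>i=1..p. entry (rotate_up n \<alpha>) i) + entry \<alpha> 1 = (\<Sum>i=1..p. entry \<alpha> i) + n"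
proof -
  note D = indicesD[OF z]
  obtain p' where p': "p = Suc p'" using p by (cases p) auto
  have "(\<Sum>i=1..p. entry (rotate_up n \<alpha>) i) = (\<Sum>i=1..p'. entry (rotate_up n \<alpha>) i) + entry (rotate_up n \<alpha>) p"
    unfolding p' by (simp add: sum.nat_ivl_Suc')
  also have "\<dots> = (\<Sum>i=1..p'. entry \<alpha> (Suc i)) + n"
    using entry_rotate_up[OF D(1)] p' by (intro arg_cong2[of _ _ _ _ "(+)"] sum.cong) auto
  also have "(\<Sum>i=1..p'. entry \<alpha> (Suc i)) = (\<Sum>i=2..p. entry \<alpha> i)"
    unfolding p' by (rule sum.reindex_bij_witness[of _ "\<lambda>i. i - 1" Suc]) auto
  finally have "(\<Sum>i=1..p. entry (rotate_up n \<alpha>) i) = (\<Sum>i=2..p. entry \<alpha> i) + n" .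
  moreover have "{1..p} = insert 1 {2..p}" using p by auto
  then have "(\<Sum>i=1..p. entry \<alpha> i) = entry \<alpha> 1 + (\<Sum>i=2..p. entry \<alpha> i)" by simp
  ultimately show ?thesis by simp
qed

definition can_rotate :: "nat \<Rightarrow> nat \<Rightarrow> nat list \<Rightarrow> nat \<Rightarrow> bool" where
  "can_rotate m p \<alpha> a \<longleftrightarrow> 1 \<le> a \<and> entry \<alpha> 1 = 1 \<and> entry \<alpha> p < m + p"

definition down_neighbours :: "nat \<Rightarrow> nat \<Rightarrow> nat list \<Rightarrow> nat \<Rightarrow> (nat list \<times> nat) set" where
  "down_neighbours m p \<alpha> a = (\<lambda>k. (lower \<alpha> k, a)) ` {k \<in> {1..p}. lowerable \<alpha> k}
     \<union> (if can_rotate m p \<alpha> a then {(rotate_up (m + p) \<alpha>, a - 1)} else {})"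

lemma down_neighbours_cases:
  assumes "y \<in> down_neighbours m p \<alpha> a"
  obtains k where "y = (lower \<alpha> k, a)" "1 \<le> k" "k \<le> p" "lowerable \<alpha> k"
    | "y = (rotate_up (m + p) \<alpha>, a - 1)" "can_rotate m p \<alpha> a"
  using assms by (auto simp: down_neighbours_def split: if_splits)

lemma down_neighbours_props:
  assumes z: "(\<alpha>, a) \<in> indices q m p" and p: "p \<ge> 1" and y: "y \<in> down_neighbours m p \<alpha> a"
  shows "y \<in> indices q m p" "index_less p y (\<alpha>, a)" "index_rank m p y + 1 = index_rank m p (\<alpha>, a)"
proof -
  note D = indicesD[OF z]
  have "y \<in> indices q m p \<and> index_le p y (\<alpha>, a) \<and> index_rank m p y + 1 = index_rank m p (\<alpha>, a)"
    using y
  proof (cases rule: down_neighbours_cases)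
    case (1 k)
    note E = entry_lower[OF D(1) _ _ 1(2,3)]
    have mem: "y \<in> indices q m p" unfolding 1(1) by (rule lower_in_indices[OF z 1(2-4)])
    moreover have "index_le p y (\<alpha>, a)" by (auto simp: index_le_def 1(1) E)
    moreover have "index_rank m p y + 1 = index_rank m p (\<alpha>, a)"
      using index_rank_plus[OF mem[unfolded 1(1)]] index_rank_plus[OF z] sum_entry_lower[OF z 1(2,3)]
      unfolding 1(1) by linarith
    ultimately show ?thesis by blast
  next
    case 2
    then have a: "1 \<le> a" and first: "entry \<alpha> 1 = 1" and last: "entry \<alpha> p < m + p" by (auto simp: can_rotate_def)
    have mem: "y \<in> indices q m p" unfolding 2(1) by (rule rotate_up_in_indices[OF z p last])
    moreover have "index_le p y (\<alpha>, a)"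
    proof -
      have "entry (rotate_up (m + p) \<alpha>) i \<le> entry \<alpha> (Suc i)" if "1 \<le> i" "i \<le> p - 1" for i
      proof -
        have "i < p" using that by linarith
        then show ?thesis using entry_rotate_up[OF D(1), of i "m + p"] that by simp
      qed
      then show ?thesis using a by (auto simp: index_le_def 2(1))
    qed
    moreover have "index_rank m p y + 1 = index_rank m p (\<alpha>, a)"
    proof -
      have "a * (m + p) = (a - 1) * (m + p) + (m + p)" using a by (cases a) auto
      then show ?thesis
        using index_rank_plus[OF mem[unfolded 2(1)]] index_rank_plus[OF z] sum_entry_rotate_up[OF z p, of "m + p"] first
        unfolding 2(1) by linarith
    qed
    ultimately show ?thesis by blast
  qed
  then show "y \<in> indices q m p" "index_less p y (\<alpha>, a)" "index_rank m p y + 1 = index_rank m p (\<alpha>, a)"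
    by (auto simp: index_less_def)
qed

lemma lower_below:
  assumes z: "(\<alpha>, a) \<in> indices q m p" and k: "1 \<le> k" "k \<le> p"
    and le: "index_le p (\<beta>, b) (\<alpha>, a)"
    and strict: "\<And>i. i \<in> {1..p - (a - b)} \<Longrightarrow> a - b + i = k \<Longrightarrow> entry \<beta> i < entry \<alpha> k"
  shows "index_le p (\<beta>, b) (lower \<alpha> k, a)"
proof -
  note E = entry_lower[OF indicesD(1)[OF z] _ _ k]
  have "entry \<beta> i \<le> entry (lower \<alpha> k) (a - b + i)" if i: "i \<in> {1..p - (a - b)}" for i
  proof -
    define j where "j = a - b + i"
    have j: "1 \<le> j" "j \<le> p" using i by (auto simp: j_def)
    have "entry \<beta> i \<le> entry \<alpha> j" using le i by (auto simp: index_le_def j_def)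
    moreover have "entry \<beta> i < entry \<alpha> k" if "j = k" using strict[OF i] that by (simp add: j_def)
    ultimately show ?thesis unfolding j_def[symmetric] E[OF j] by auto
  qed
  then show ?thesis using le by (auto simp: index_le_def)
qed

text \<open>Every smaller index lies below one of the candidates for a cover. If \<open>a = b\<close>, lower the first
  entry where \<open>\<alpha>\<close> and \<open>\<beta>\<close> differ. If \<open>b < a\<close>, the first entry of \<open>\<alpha>\<close> is not compared with \<open>\<beta>\<close>, so it may be
  lowered or, if it is \<open>1\<close> and \<open>\<alpha>\<^sub>p < n\<close>, rotated away. There remains \<open>\<alpha>\<^sub>1 = 1\<close>, \<open>\<alpha>\<^sub>p = n\<close>: then the
  entry starting the final run of consecutive numbers can be lowered, because it is as large as
  its position permits and is compared, if at all, with an entry of \<open>\<beta>\<close> further to the left.\<close>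

lemma below_down_neighbour:
  assumes y: "(\<beta>, b) \<in> indices q m p" and z: "(\<alpha>, a) \<in> indices q m p"
    and less: "index_less p (\<beta>, b) (\<alpha>, a)" and p: "p \<ge> 1" and m: "m \<ge> 1"
  shows "\<exists>y'\<in>down_neighbours m p \<alpha> a. index_le p (\<beta>, b) y'"
proof -
  note D = indicesD[OF z] and Dy = indicesD[OF y]
  define d where "d = a - b"
  have leq: "index_le p (\<beta>, b) (\<alpha>, a)" using less by (simp add: index_less_def)
  have ba: "b \<le> a" and le: "\<And>i. 1 \<le> i \<Longrightarrow> i \<le> p - d \<Longrightarrow> entry \<beta> i \<le> entry \<alpha> (d + i)"
    and ne: "(\<beta>, b) \<noteq> (\<alpha>, a)"
    using less by (auto simp: index_less_def index_le_def d_def)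
  have lowerI: ?thesis if k: "1 \<le> k" "k \<le> p" "lowerable \<alpha> k"
    and strict: "\<And>i. 1 \<le> i \<Longrightarrow> i \<le> p - d \<Longrightarrow> d + i = k \<Longrightarrow> entry \<beta> i < entry \<alpha> k" for k
  proof (rule bexI)
    show "index_le p (\<beta>, b) (lower \<alpha> k, a)"
      by (rule lower_below[OF z k(1,2) leq]) (use strict in \<open>auto simp: d_def\<close>)
    show "(lower \<alpha> k, a) \<in> down_neighbours m p \<alpha> a"
      using k by (auto simp: down_neighbours_def)
  qed
  show ?thesis
  proof (cases "d = 0")
    case True
    have ex: "\<exists>i. 1 \<le> i \<and> i \<le> p \<and> entry \<beta> i < entry \<alpha> i"
    proof (rule ccontr)
      assume "\<not> ?thesis"
      then have "entry \<beta> i = entry \<alpha> i" if "1 \<le> i" "i \<le> p" for i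
        using le[of i] that True by (force simp: not_less)
      then have "\<beta> = \<alpha>" by (rule entry_eqI[OF Dy(1) D(1)])
      then show False using ne True ba by (simp add: d_def)
    qed
    define k where "k = (LEAST i. 1 \<le> i \<and> i \<le> p \<and> entry \<beta> i < entry \<alpha> i)"
    have k: "1 \<le> k" "k \<le> p" "entry \<beta> k < entry \<alpha> k" using LeastI_ex[OF ex] by (auto simp: k_def)
    have eq: "entry \<beta> i = entry \<alpha> i" if i: "1 \<le> i" "i < k" for i
    proof -
      have "\<not> (1 \<le> i \<and> i \<le> p \<and> entry \<beta> i < entry \<alpha> i)"
        by (rule not_less_Least) (use i(2) in \<open>simp only: k_def\<close>)
      then show ?thesis using le[of i] i k(2) True by simp
    qed
    have "lowerable \<alpha> k"
    proof (cases "k = 1")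
      case True
      then show ?thesis using k Dy(4)[of 1] p by (simp add: lowerable_def)
    next
      case False
      then have "entry \<beta> (k - 1) < entry \<beta> k" "entry \<beta> (k - 1) = entry \<alpha> (k - 1)"
        using Dy(3)[of "k - 1" k] eq[of "k - 1"] k by auto
      then show ?thesis using False k by (simp add: lowerable_def)
    qed
    then show ?thesis by (rule lowerI[OF k(1,2)]) (use True k in auto)
  next
    case False
    then have d: "1 \<le> d" by simp
    consider "entry \<alpha> 1 > 1" | "entry \<alpha> 1 = 1" "entry \<alpha> p < m + p" | "entry \<alpha> 1 = 1" "entry \<alpha> p = m + p"
      using D(4)[of 1] D(4)[of p] p by force
    then show ?thesis
    proof cases
      case 1
      show ?thesis by (rule lowerI[of 1]) (use 1 p d in \<open>auto simp: lowerable_def\<close>)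
    next
      case 2
      have "can_rotate m p \<alpha> a" using 2 d by (auto simp: can_rotate_def d_def)
      moreover have "index_le p (\<beta>, b) (rotate_up (m + p) \<alpha>, a - 1)"
      proof -
        have "entry \<beta> i \<le> entry (rotate_up (m + p) \<alpha>) (a - 1 - b + i)" if i: "i \<in> {1..p - (a - 1 - b)}" for i
        proof -
          have j: "a - 1 - b + i = d - 1 + i" by (simp add: d_def)
          have i': "1 \<le> d - 1 + i" "d - 1 + i \<le> p" "1 \<le> i" "i \<le> p" using i unfolding d_def by auto
          have "entry (rotate_up (m + p) \<alpha>) (d - 1 + i) = (if d - 1 + i < p then entry \<alpha> (d + i) else m + p)"
            using entry_rotate_up[OF D(1) i'(1,2)] d by simp
          then show ?thesis using le[of i] Dy(4)[of i] i' unfolding j by auto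
        qed
        then show ?thesis using d by (auto simp: index_le_def d_def)
      qed
      ultimately show ?thesis by (intro bexI[of _ "(rotate_up (m + p) \<alpha>, a - 1)"]) (auto simp: down_neighbours_def)
    next
      case 3
      let ?Q = "\<lambda>k. 1 \<le> k \<and> k \<le> p \<and> entry \<alpha> k = m + k"
      have ex: "\<exists>k. ?Q k" using 3 p by (intro exI[of _ p]) simp
      \<comment> \<open>No index has \<open>\<alpha>\<^sub>k > m + k\<close>, so equality at \<open>k\<close> persists up to \<open>p\<close>.\<close>
      define k where "k = (LEAST k. ?Q k)"
      have k: "1 \<le> k" "k \<le> p" "entry \<alpha> k = m + k" using LeastI_ex[OF ex] by (auto simp: k_def)
      have k1: "k \<noteq> 1" using k 3 m by auto
      then have k2: "2 \<le> k" using k(1) by linarith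
      have "entry \<alpha> (k - 1) \<noteq> m + (k - 1)"
      proof
        assume "entry \<alpha> (k - 1) = m + (k - 1)"
        then have "?Q (k - 1)" using k(2) k2 by (intro conjI) linarith+
        then have "k \<le> k - 1" unfolding k_def by (rule Least_le)
        then show False using k by simp
      qed
      moreover have "entry \<alpha> (k - 1) \<le> m + (k - 1)"
        by (rule entry_bounds(2)[OF z]) (use k(2) k2 in linarith)+
      ultimately have "entry \<alpha> (k - 1) < m + (k - 1)" by linarith
      then have low: "lowerable \<alpha> k" using k k1 by (simp add: lowerable_def)
      show ?thesis
      proof (rule lowerI[OF k(1,2) low])
        fix i assume i: "1 \<le> i" "i \<le> p - d" "d + i = k"
        then show "entry \<beta> i < entry \<alpha> k" using entry_bounds(2)[OF y, of i] k d by simp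
      qed
    qed
  qed
qed

text \<open>The candidates have rank one less than \<open>\<alpha>\<^sup>(\<^sup>a\<^sup>)\<close>, which leaves no room for an index in between, and
  any other smaller index lies strictly below one of them.\<close>

lemma covered_by_eq:
  assumes z: "(\<alpha>, a) \<in> indices q m p" and p: "p \<ge> 1" and m: "m \<ge> 1"
  shows "{y. covered_by q m p y (\<alpha>, a)} = down_neighbours m p \<alpha> a"
proof (rule equalityI; rule subsetI)
  fix y assume "y \<in> {y. covered_by q m p y (\<alpha>, a)}"
  then have y: "y \<in> indices q m p" "index_less p y (\<alpha>, a)"
    and no: "\<And>w. w \<in> indices q m p \<Longrightarrow> index_less p y w \<Longrightarrow> \<not> index_less p w (\<alpha>, a)"
    by (auto simp: covered_by_def)
  obtain \<beta> b where yb: "y = (\<beta>, b)" by (cases y)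
  obtain y' where y': "y' \<in> down_neighbours m p \<alpha> a" "index_le p y y'"
    using below_down_neighbour[OF y(1)[unfolded yb] z y(2)[unfolded yb] p m] unfolding yb by (elim bexE)
  have "y = y'"
  proof (rule ccontr)
    assume "y \<noteq> y'"
    then have "index_less p y y'" using y'(2) by (simp add: index_less_def)
    then show False using no down_neighbours_props(1,2)[OF z p y'(1)] by simp
  qed
  then show "y \<in> down_neighbours m p \<alpha> a" using y'(1) by simp
next
  fix y assume y: "y \<in> down_neighbours m p \<alpha> a"
  note P = down_neighbours_props[OF z p y]
  have False if w: "w \<in> indices q m p" "index_less p y w" "index_less p w (\<alpha>, a)" for w :: "nat list \<times> nat"
  proof -
    obtain \<gamma> c where wc: "w = (\<gamma>, c)" by (cases w)
    obtain \<beta> b where yb: "y = (\<beta>, b)" by (cases y)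
    have "index_rank m p y < index_rank m p w"
      using index_rank_strict_mono[of \<beta> b q m p \<gamma> c] P(1) w p by (simp add: wc yb)
    moreover have "index_rank m p w < index_rank m p (\<alpha>, a)"
      using index_rank_strict_mono[of \<gamma> c q m p \<alpha> a] z w p by (simp add: wc)
    ultimately show False using P(3) by linarith
  qed
  then show "y \<in> {y. covered_by q m p y (\<alpha>, a)}" using P(1,2) z by (auto simp: covered_by_def)
qed

section \<open>The recursion\<close>

text \<open>The alternant exponents of \<open>S\<close> at the dual index: entry \<open>p + 1 - j\<close> of the dual is \<open>n + 1 - \<alpha>\<^sub>j\<close>.\<close>

definition co_exponents :: "nat \<Rightarrow> nat list \<Rightarrow> nat \<Rightarrow> nat" where
  "co_exponents n \<alpha> j = n - entry \<alpha> j"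

definition delta_scale :: "nat \<Rightarrow> nat \<Rightarrow> complex" where
  "delta_scale m p = (- 1) ^ (p choose 2) / (fact p * (of_nat (m + p) * (- 1) ^ (p + 1)) ^ p)"

lemma alternant_cong: "(\<And>j. j \<in> {1..p} \<Longrightarrow> \<mu> j = \<nu> j) \<Longrightarrow> alternant p \<mu> = alternant p \<nu>"
  unfolding alternant_def by (intro arg_cong[of _ _ det] eq_matI) auto

lemma delta_eq_alt_sum:
  assumes z: "(\<alpha>, a) \<in> indices q m p" and p: "p \<ge> 1" and m: "m \<ge> 1"
  shows "delta m p (\<alpha>, a) = delta_scale m p * alt_sum m p (index_rank m p (\<alpha>, a)) (co_exponents (m + p) \<alpha>)"
proof -
  let ?l = "\<lambda>j. entry (dual m p \<alpha>) (p + 1 - j) - (p + 1 - j)"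
  let ?S = "schur_seq p (dual m p \<alpha>)"
  have "?l j + p - j = co_exponents (m + p) \<alpha> j" if j: "j \<in> {1..p}" for j
  proof -
    have "p + 1 - j - 1 < length [1..<p + 1]" using j by auto
    then have "entry (dual m p \<alpha>) (p + 1 - j) = m + p + 1 - entry \<alpha> (p + 1 - ([1..<p + 1] ! (p + 1 - j - 1)))"
      unfolding entry_def[of "dual m p \<alpha>"] unfolding dual_def by (rule nth_map)
    also have "[1..<p + 1] ! (p + 1 - j - 1) = p + 1 - j" using j by (subst nth_upt) auto
    also have "p + 1 - (p + 1 - j) = j" using j by auto
    finally show ?thesis
      using entry_bounds[OF z, of j] j by (auto simp: co_exponents_def)
  qed
  then have "alternant p (\<lambda>j. ?l j + p - j) = alternant p (co_exponents (m + p) \<alpha>)"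
    by (rule alternant_cong)
  then have "?S * alternant p (\<lambda>j. p - j) = alternant p (co_exponents (m + p) \<alpha>)"
    unfolding schur_seq_def by (simp only: schur_times_alternant[OF p])
  moreover have "in_elems p ?S" unfolding schur_seq_def by (rule in_elems_schur[OF p])
  ultimately show ?thesis
    using residue_sum_eq_alt_sum[OF p m, of ?S "co_exponents (m + p) \<alpha>" "index_rank m p (\<alpha>, a)"]
    by (simp add: delta_def delta_scale_def)
qed

text \<open>The term of Pieri's rule that belongs to entry \<open>k\<close>. If \<open>k\<close> is not lowerable, then either the raised
  exponent equals its neighbour, or \<open>k = 1\<close> and the exponent has reached \<open>n\<close>.\<close>

lemma alt_sum_step:
  assumes z: "(\<alpha>, a) \<in> indices q m p" and p: "p \<ge> 1" and m: "m \<ge> 1" and k: "k \<in> {1..p}"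
  defines "\<mu> \<equiv> co_exponents (m + p) \<alpha>"
  shows "alt_sum m p r (\<mu>(k := \<mu> k + 1)) =
    (if lowerable \<alpha> k then alt_sum m p r (co_exponents (m + p) (lower \<alpha> k))
     else if k = 1 \<and> entry \<alpha> p < m + p then alt_sum m p r (co_exponents (m + p) (rotate_up (m + p) \<alpha>))
     else 0)"
proof -
  note D = indicesD[OF z]
  have k': "1 \<le> k" "k \<le> p" using k by auto
  consider (low) "lowerable \<alpha> k" | (inner) "\<not> lowerable \<alpha> k" "k \<noteq> 1" | (first) "\<not> lowerable \<alpha> k" "k = 1" by blast
  then show ?thesis
  proof cases
    case low
    have "alt_sum m p r (\<mu>(k := \<mu> k + 1)) = alt_sum m p r (co_exponents (m + p) (lower \<alpha> k))"
      by (rule alt_sum_cong) (use entry_lower[OF D(1) _ _ k'] D(4)[OF k'] in \<open>auto simp: \<mu>_def co_exponents_def\<close>)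
    then show ?thesis using low by simp
  next
    case inner
    have "entry \<alpha> (k - 1) < entry \<alpha> k" using D(3)[of "k - 1" k] inner k' by auto
    then have "entry \<alpha> k = entry \<alpha> (k - 1) + 1" using inner by (simp add: lowerable_def)
    then have "\<mu> k + 1 = \<mu> (k - 1)" using D(4)[OF k'] by (simp add: \<mu>_def co_exponents_def)
    then have "alt_sum m p r (\<mu>(k := \<mu> k + 1)) = 0"
      using inner k' by (intro alt_sum_eq_0_if_eq_exponents[of k p "k - 1"]) auto
    then show ?thesis using inner by simp
  next
    case first
    then have a1: "entry \<alpha> 1 = 1" using D(4)[of 1] p by (auto simp: lowerable_def)
    let ?\<nu> = "co_exponents (m + p) (rotate_up (m + p) \<alpha>)"
    have \<nu>: "?\<nu> j = (if j < p then \<mu> (j + 1) else 0)" if "j \<in> {1..p}" for j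
      using entry_rotate_up[OF D(1), of j "m + p"] that by (auto simp: \<mu>_def co_exponents_def)
    have eq: "alt_sum m p r (\<mu>(k := \<mu> k + 1)) = alt_sum m p r ?\<nu>"
      by (rule alt_sum_quantum_shift[OF p]) (use \<nu> p a1 first in \<open>auto simp: \<mu>_def co_exponents_def\<close>)
    show ?thesis
    proof (cases "entry \<alpha> p < m + p")
      case True
      then show ?thesis using eq first by simp
    next
      case False
      then have "entry \<alpha> p = m + p" using D(4)[of p] p by auto
      then have "\<mu> p = 0" and "p \<noteq> 1" using a1 m by (auto simp: \<mu>_def co_exponents_def)
      then have "alt_sum m p r ?\<nu> = 0"
        using p by (intro alt_sum_eq_0_if_eq_exponents[of "p - 1" p p]) (auto simp: \<nu>)
      then show ?thesis using eq first False by simp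
    qed
  qed
qed

text \<open>For \<open>a = 0\<close> the rotated sequence does not belong to an index. Here the total degree, including
  the Vandermonde determinant and the factor \<open>\<Prod>\<^sub>i x\<^sub>i\<close>, is \<open>p n - n\<close>.\<close>

lemma alt_sum_rotate_eq_0:
  assumes z: "(\<alpha>, 0) \<in> indices q m p" and p: "p \<ge> 1" and first: "entry \<alpha> 1 = 1"
    and r: "index_rank m p (\<alpha>, 0) = Suc r"
  shows "alt_sum m p r (co_exponents (m + p) (rotate_up (m + p) \<alpha>)) = 0"
proof (rule alt_sum_eq_0_if_low_degree[OF p])
  let ?\<rho> = "rotate_up (m + p) \<alpha>"
  note D = indicesD[OF z]
  have "entry ?\<rho> j \<le> m + p" if "j \<in> {1..p}" for j
    using entry_rotate_up[OF D(1), of j "m + p"] D(4)[of "j + 1"] that by auto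
  then have "(\<Sum>j=1..p. co_exponents (m + p) ?\<rho> j) + (\<Sum>j=1..p. entry ?\<rho> j) = (\<Sum>j=1..p. m + p)"
    unfolding sum.distrib[symmetric] by (intro sum.cong) (auto simp: co_exponents_def)
  also have "\<dots> = p * (m + p)" by simp
  finally have A: "(\<Sum>j=1..p. co_exponents (m + p) ?\<rho> j) + (\<Sum>j=1..p. entry ?\<rho> j) = p * (m + p)" .
  have B: "(\<Sum>j=1..p. entry ?\<rho> j) + 1 = (\<Sum>j=1..p. entry \<alpha> j) + (m + p)"
    using sum_entry_rotate_up[OF z p, of "m + p"] first by simp
  have C: "Suc r + (\<Sum>j=1..p. j) = (\<Sum>j=1..p. entry \<alpha> j)"
    using index_rank_plus[OF z] r by simp
  have "(\<Sum>j=1..p. p - j) + (\<Sum>j=1..p. j) = (\<Sum>j=1..p. p)"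
    unfolding sum.distrib[symmetric] by (rule sum.cong) auto
  then have G1: "(\<Sum>j=1..p. p - j) + (\<Sum>j=1..p. j) = p * p" by simp
  have G2: "2 * (\<Sum>j=1..p. j) = p * p + p"
    using gauss_sum_from_Suc_0[of p, where ?'a = nat] by (simp add: double_gauss_sum_from_Suc_0)
  show "r + (\<Sum>j\<in>{1..p}. co_exponents (m + p) ?\<rho> j) + (\<Sum>j\<in>{1..p}. p - j) + p < p * (m + p)"
    using A B C G1 G2 p by linarith
qed

lemma index_rank_pos:
  assumes z: "(\<alpha>, a) \<in> indices q m p" and p: "p \<ge> 1" and ne: "(\<alpha>, a) \<noteq> ([1..<p + 1], 0)"
  shows "index_rank m p (\<alpha>, a) > 0"
proof (cases "a = 0")
  case True
  note D = indicesD[OF z]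
  have "\<exists>i\<in>{1..p}. entry \<alpha> i \<noteq> i"
  proof (rule ccontr)
    assume "\<not> ?thesis"
    then have "entry \<alpha> i = entry [1..<p + 1] i" if "1 \<le> i" "i \<le> p" for i
      using that by (auto simp: entry_def nth_upt simp del: upt_Suc)
    then have "\<alpha> = [1..<p + 1]" by (intro entry_eqI[OF D(1)]) auto
    then show False using ne True by simp
  qed
  then obtain i where i: "i \<in> {1..p}" "entry \<alpha> i \<noteq> i" by blast
  then have "entry \<alpha> i - i > 0" using entry_bounds(1)[OF z, of i] by simp
  moreover have "entry \<alpha> i - i \<le> (\<Sum>i=1..p. entry \<alpha> i - i)"
    using member_le_sum[of i "{1..p}" "\<lambda>i. entry \<alpha> i - i"] i(1) by simp
  ultimately show ?thesis unfolding index_rank_def prod.case by linarith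
next
  case False
  then show ?thesis using p by (simp add: index_rank_def)
qed

lemma sum_down_neighbours:
  assumes z: "(\<alpha>, a) \<in> indices q m p"
  shows "(\<Sum>y\<in>down_neighbours m p \<alpha> a. f y) = (\<Sum>k | k \<in> {1..p} \<and> lowerable \<alpha> k. f (lower \<alpha> k, a))
    + (if can_rotate m p \<alpha> a then f (rotate_up (m + p) \<alpha>, a - 1) else (0 :: complex))"
proof -
  note D = indicesD[OF z]
  let ?K = "{k \<in> {1..p}. lowerable \<alpha> k}"
  have inj: "inj_on (\<lambda>k. (lower \<alpha> k, a)) ?K"
  proof (rule inj_onI, rule ccontr)
    fix k l assume kl: "k \<in> ?K" "l \<in> ?K" "(lower \<alpha> k, a) = (lower \<alpha> l, a)" "k \<noteq> l"
    then have "entry (lower \<alpha> k) k = entry (lower \<alpha> l) k" by simp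
    then have "entry \<alpha> k - 1 = entry \<alpha> k"
      using entry_lower[OF D(1), of k k] entry_lower[OF D(1), of k l] kl by auto
    then show False using D(4)[of k] kl by auto
  qed
  let ?L = "(\<lambda>k. (lower \<alpha> k, a)) ` ?K"
  have L: "(\<Sum>y\<in>?L. f y) = (\<Sum>k\<in>?K. f (lower \<alpha> k, a))"
    using sum.reindex[OF inj, of f] by (simp only: o_def)
  have fin: "finite ?L" by simp
  show ?thesis
  proof (cases "can_rotate m p \<alpha> a")
    case True
    then have new: "(rotate_up (m + p) \<alpha>, a - 1) \<notin> ?L"
      by (auto simp: can_rotate_def)
    moreover have "down_neighbours m p \<alpha> a = insert (rotate_up (m + p) \<alpha>, a - 1) ?L"
      unfolding down_neighbours_def if_P[OF True] by (rule Un_commute[THEN trans]) (rule Un_insert_left[THEN trans], simp)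
    ultimately show ?thesis
      using sum.insert[OF fin new, of f] L True by (simp only: if_True add.commute)
  next
    case False
    then show ?thesis unfolding down_neighbours_def if_not_P[OF False] using L by (simp only: Un_empty_right add_0_right)
  qed
qed

theorem theorem5p2:
  fixes m p q a :: nat and \<alpha> :: "nat list"
  assumes "m \<ge> 1" and "p \<ge> 1"
    and "(\<alpha>, a) \<in> indices q m p"
    and "(\<alpha>, a) \<noteq> ([1..<p + 1], 0)"
  shows "delta m p (\<alpha>, a) = (\<Sum>y | covered_by q m p y (\<alpha>, a). delta m p y)"
proof -
  note m = assms(1) and p = assms(2) and z = assms(3)
  let ?n = "m + p" and ?c = "delta_scale m p" and ?\<mu> = "co_exponents (m + p) \<alpha>" and ?\<rho> = "rotate_up (m + p) \<alpha>"
  obtain r where r: "index_rank m p (\<alpha>, a) = Suc r"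
    using index_rank_pos[OF z p assms(4)] by (cases "index_rank m p (\<alpha>, a)") auto
  have neighbour: "delta m p (\<beta>, b) = ?c * alt_sum m p r (co_exponents ?n \<beta>)"
    if y: "(\<beta>, b) \<in> down_neighbours m p \<alpha> a" for \<beta> b
    using delta_eq_alt_sum[OF down_neighbours_props(1)[OF z p y] p m] down_neighbours_props(3)[OF z p y] r
    by simp
  \<comment> \<open>The contribution of lowering \<open>\<alpha>\<^sub>1 = 1\<close>; it counts regardless of \<open>a\<close>.\<close>
  define R where "R = (if \<not> lowerable \<alpha> 1 \<and> entry \<alpha> p < ?n then alt_sum m p r (co_exponents ?n ?\<rho>) else 0)"
  have "alt_sum m p (Suc r) ?\<mu> = (\<Sum>k\<in>{1..p}. alt_sum m p r (?\<mu>(k := ?\<mu> k + 1)))"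
    by (rule alt_sum_Suc)
  also have "\<dots> = (\<Sum>k\<in>{1..p}. (if lowerable \<alpha> k then alt_sum m p r (co_exponents ?n (lower \<alpha> k)) else 0)
      + (if k = 1 then R else 0))"
    by (rule sum.cong[OF refl], subst alt_sum_step[OF z p m]) (auto simp: R_def)
  also have "\<dots> = (\<Sum>k | k \<in> {1..p} \<and> lowerable \<alpha> k. alt_sum m p r (co_exponents ?n (lower \<alpha> k))) + R"
    unfolding sum.distrib sum.inter_filter[OF finite_atLeastAtMost] using p by simp
  finally have main: "delta m p (\<alpha>, a) =
      (\<Sum>k | k \<in> {1..p} \<and> lowerable \<alpha> k. ?c * alt_sum m p r (co_exponents ?n (lower \<alpha> k))) + ?c * R"
    unfolding delta_eq_alt_sum[OF z p m] r by (simp only: distrib_left sum_distrib_left)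
  have low: "?c * alt_sum m p r (co_exponents ?n (lower \<alpha> k)) = delta m p (lower \<alpha> k, a)"
    if "k \<in> {k \<in> {1..p}. lowerable \<alpha> k}" for k
    by (rule neighbour[symmetric]) (use that in \<open>auto simp: down_neighbours_def\<close>)
  have "?c * R = (if can_rotate m p \<alpha> a then delta m p (?\<rho>, a - 1) else 0)"
  proof (cases "can_rotate m p \<alpha> a")
    case True
    then have "(?\<rho>, a - 1) \<in> down_neighbours m p \<alpha> a" by (auto simp: down_neighbours_def)
    then show ?thesis using neighbour[of ?\<rho> "a - 1"] True by (simp add: R_def can_rotate_def lowerable_def)
  next
    case False
    have "R = 0"
    proof (cases "\<not> lowerable \<alpha> 1 \<and> entry \<alpha> p < ?n")
      case True
      then have "entry \<alpha> 1 = 1" using indicesD(4)[OF z, of 1] p by (auto simp: lowerable_def)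
      moreover from this have "a = 0" using False True by (auto simp: can_rotate_def)
      ultimately show ?thesis using alt_sum_rotate_eq_0[of \<alpha> q m p r] z p r by (simp add: R_def)
    qed (simp only: R_def if_False)
    then show ?thesis using False by simp
  qed
  moreover have "(\<Sum>k | k \<in> {1..p} \<and> lowerable \<alpha> k. ?c * alt_sum m p r (co_exponents ?n (lower \<alpha> k)))
      = (\<Sum>k | k \<in> {1..p} \<and> lowerable \<alpha> k. delta m p (lower \<alpha> k, a))"
    by (rule sum.cong[OF refl]) (rule low)
  ultimately show ?thesis
    unfolding covered_by_eq[OF z p m] sum_down_neighbours[OF z] main by simp
qed

end
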